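(* Assume the setting and standing assumption described in the context, and let $t_0\ge1$. Suppose that for all $t\ge t_0$ $$1+\theta-\theta t\alpha(t)<0,\qquad (2\theta-1)\beta(t)+\theta t\dot\beta(t)\le 0,\qquad \alpha(t)+t\dot\alpha(t)<t\beta(t)\epsilon(t),$$ and that $\lim_{t\to+\infty}t^2\beta(t)\epsilon(t)=+\infty$. Set $$l(t)=\frac{1}{\theta t}\left(\beta(t)\epsilon(t)-\dot\alpha(t)-\frac{\alpha(t)}{t}\right),\qquad \Gamma(t)=\alpha(t)-\frac{1+\theta}{\theta t},$$ $$H(t)=\beta(t)+\beta(t)\epsilon(t)+\alpha(t)-\frac{1}{\theta t},\qquad \Psi(t)=\left(\frac{|\dot\epsilon(t)|}{\epsilon(t)}\right)^2\left(\frac{H^2(t)}{l(t)}+\frac{1}{t^2\Gamma(t)}\right).$$ If $$\lim_{t\to+\infty}\frac{\int_{t_0}^{t}\tau^2\Psi(\tau)\,\mathrm{d}\tau}{t^2\beta(t)\epsilon(t)}=0,$$ then $$\lim_{t\to+\infty}\frac{\int_{t_0}^{t}\tau^2\mathcal{R}(\tau)\,\mathrm{d}\tau}{t^2\beta(t)\epsilon(t)}=0,$$ where, with $(x_t,y_t)$ the unique saddle point of $\mathcal{L}_t$, $$\mathcal{R}(t)=\frac{\|P_x(t)\|^2+\|P_y(t)\|^2}{l(t)}+\frac{\|\dot x_t\|^2+\|\dot y_t\|^2}{2\theta^2t^2\Gamma(t)},$$ $$P_x(t)=-\beta(t)K^*\dot y_t-\beta(t)\dot\epsilon(t)x_t+\frac{\alpha(t)-t^{-1}}{\theta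 t}\dot x_t,\qquad P_y(t)=\beta(t)K\dot x_t-\beta(t)\dot\epsilon(t)y_t+\frac{\alpha(t)-t^{-1}}{\theta t}\dot y_t.$$ Consequently, every trajectory $(x(t),y(t))$ generated by the system (GTRD) converges strongly to the minimum-norm saddle point $(\hat x^*,\hat y^* )=\operatorname{Proj}_\Omega0$, i.e. $\lim_{t\to+\infty}\|(x(t),y(t))-(\hat x^*,\hat y^* )\|=0$.
   Context: Standing assumption: $f:\mathbb{R}^n\to\mathbb{R}$ and $g:\mathbb{R}^m\to\mathbb{R}$ are continuously differentiable convex functions whose gradients $\nabla f$, $\nabla g$ are $L_1$- and $L_2$-Lipschitz continuous, respectively, with $L_1,L_2>0$; $K\in\mathbb{R}^{m\times n}$ with adjoint $K^*$; $t_0>0$ and $\theta>0$ are constants; $\alpha,\beta,\epsilon:[t_0,+\infty)\to(0,+\infty)$ are of class $\mathcal{C}^1$, and $\epsilon$ is nonincreasing with $\lim_{t\to+\infty}\epsilon(t)=0$. Norms and inner products are Euclidean, $\|(x,y)\|=\sqrt{\|x\|^2+\|y\|^2}$. Lagrangian: $\mathcal{L}(x,y)=f(x)+\langle Kx,y\rangle-g(y)$ on $\mathbb{R}^n\times\mathbb{R}^m$. A pair $(x^*,y^* )$ is a saddle point of a function $\mathcal{M}$ if $\mathcal{M}(x^*,y)\le\mathcal{M}(x^*,y^* )\le\mathcal{M}(x,y^* )$ for all $(x,y)\in\mathbb{R}^n\times\mathbb{R}^m$; $\Omega$ is the set of saddle points of $\mathcal{L}$, assumed nonempty, closed and convex,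 and $\operatorname{Proj}_\Omega 0$ is the projection of the origin onto $\Omega$, i.e. the unique element of $\Omega$ of minimal norm. Regularized function: $\mathcal{L}_t(x,y)=\mathcal{L}(x,y)+\frac{\epsilon(t)}{2}(\|x\|^2-\|y\|^2)$; it has a unique saddle point $(x_t,y_t)$. The map $t\mapsto(x_t,y_t)$ is locally Lipschitz on $[t_0,+\infty)$, and $\dot x_t,\dot y_t$ denote its derivatives with respect to $t$, which exist for almost every $t\ge t_0$; accordingly $P_x,P_y,\mathcal{R}$ are defined almost everywhere. System (GTRD), for $t\ge t_0$: $$\ddot x(t)+\alpha(t)\dot x(t)+\beta(t)\nabla_x\mathcal{L}_t\big(x(t),y(t)+\theta t\dot y(t)\big)=0,$$ $$\ddot y(t)+\alpha(t)\dot y(t)-\beta(t)\nabla_y\mathcal{L}_t\big(x(t)+\theta t\dot x(t),y(t)\big)=0,$$ where $\nabla_x\mathcal{L}_t(x,y)=\nabla f(x)+K^*y+\epsilon(t)x$ and $\nabla_y\mathcal{L}_t(x,y)=-\nabla g(y)+Kx-\epsilon(t)y$. A trajectory is a global strong solution: $x\in W^{2,1}_{\mathrm{loc}}([t_0,+\infty);\mathbb{R}^n)$, $y\in W^{2,1}_{\mathrm{loc}}([t_0,+\infty);\mathbb{R}^m)$, satisfying the system for almost every $t>t_0$. *)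

theory Defs
  imports "HOL-Analysis.Analysis"
begin

definition is_saddle :: "('a \<Rightarrow> 'b \<Rightarrow> real) \<Rightarrow> 'a \<times> 'b \<Rightarrow> bool" where
  "is_saddle M z \<longleftrightarrow>
     (\<forall>x y. M (fst z) y \<le> M (fst z) (snd z) \<and> M (fst z) (snd z) \<le> M x (snd z))"

text \<open>Meaningful only for functions that have exactly one saddle point.\<close>

definition the_saddle :: "('a \<Rightarrow> 'b \<Rightarrow> real) \<Rightarrow> 'a \<times> 'b" where
  "the_saddle M = (THE z. is_saddle M z)"

definition lagrangian ::
  "(real^'n \<Rightarrow> real) \<Rightarrow> (real^'m \<Rightarrow> real) \<Rightarrow> real^'n^'m \<Rightarrow> real^'n \<Rightarrow> real^'m \<Rightarrow> real" where
  "lagrangian f g K x y = f x + (K *v x) \<bullet> y - g y"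

definition reg_lagrangian ::
  "(real^'n \<Rightarrow> real) \<Rightarrow> (real^'m \<Rightarrow> real) \<Rightarrow> real^'n^'m \<Rightarrow> real \<Rightarrow> real^'n \<Rightarrow> real^'m \<Rightarrow> real" where
  "reg_lagrangian f g K e x y = lagrangian f g K x y + e / 2 * ((norm x)\<^sup>2 - (norm y)\<^sup>2)"

text \<open>The partial gradients of the regularized Lagrangian, where \<open>gf\<close> and \<open>gg\<close> are the
  gradients of \<open>f\<close> and \<open>g\<close>, and \<open>e\<close> is the value of the regularization parameter.\<close>

definition grad_x_reg ::
  "(real^'n \<Rightarrow> real^'n) \<Rightarrow> real^'n^'m \<Rightarrow> real \<Rightarrow> real^'n \<Rightarrow> real^'m \<Rightarrow> real^'n" where
  "grad_x_reg gf K e x y = gf x + transpose K *v y + e *\<^sub>R x"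

definition grad_y_reg ::
  "(real^'m \<Rightarrow> real^'m) \<Rightarrow> real^'n^'m \<Rightarrow> real \<Rightarrow> real^'n \<Rightarrow> real^'m \<Rightarrow> real^'m" where
  "grad_y_reg gg K e x y = - gg y + K *v x - e *\<^sub>R y"

text \<open>\<open>u\<close> is the continuous representative of a function in \<open>W\<^sup>1\<^sup>,\<^sup>1\<close> on every compact interval
  \<open>[t0, T]\<close>, and \<open>u'\<close> is (a representative of) its derivative: \<open>u'\<close> is locally
  integrable and \<open>u\<close> is a primitive of it. Then \<open>u\<close> is locally absolutely continuous on
  \<open>[t0, \<infinity>)\<close> and differentiable almost everywhere with derivative \<open>u'\<close>.\<close>

definition W11_loc_deriv ::
  "real \<Rightarrow> (real \<Rightarrow> 'a::euclidean_space) \<Rightarrow> (real \<Rightarrow> 'a) \<Rightarrow> bool" where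
  "W11_loc_deriv t0 u u' \<longleftrightarrow>
     (\<forall>T\<ge>t0. u' absolutely_integrable_on {t0..T} \<and> u T = u t0 + integral {t0..T} u')"

text \<open>The second derivatives are determined only almost everywhere. The first derivatives are
  taken in their continuous representatives, being themselves locally \<open>W\<^sup>1\<^sup>,\<^sup>1\<close>.\<close>

definition gtrd_trajectory ::
  "real \<Rightarrow> real \<Rightarrow> (real \<Rightarrow> real) \<Rightarrow> (real \<Rightarrow> real) \<Rightarrow> (real \<Rightarrow> real) \<Rightarrow>
   (real^'n \<Rightarrow> real^'n) \<Rightarrow> (real^'m \<Rightarrow> real^'m) \<Rightarrow> real^'n^'m \<Rightarrow>
   (real \<Rightarrow> real^'n) \<Rightarrow> (real \<Rightarrow> real^'m) \<Rightarrow> bool" where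
  "gtrd_trajectory t0 \<theta> \<alpha> \<beta> \<epsilon> gf gg K x y \<longleftrightarrow>
     (\<exists>x' x'' y' y''.
        W11_loc_deriv t0 x x' \<and> W11_loc_deriv t0 x' x'' \<and>
        W11_loc_deriv t0 y y' \<and> W11_loc_deriv t0 y' y'' \<and>
        (AE t in lebesgue. t > t0 \<longrightarrow>
           x'' t + \<alpha> t *\<^sub>R x' t
             + \<beta> t *\<^sub>R grad_x_reg gf K (\<epsilon> t) (x t) (y t + (\<theta> * t) *\<^sub>R y' t) = 0 \<and>
           y'' t + \<alpha> t *\<^sub>R y' t
             - \<beta> t *\<^sub>R grad_y_reg gg K (\<epsilon> t) (x t + (\<theta> * t) *\<^sub>R x' t) (y t) = 0))"

end

theory Submission
  imports Defs
begin

text \<open>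
  Write \<open>z = (x, y)\<close>, \<open>\<phi> z = f x + g y\<close> with gradient \<open>G\<close>, and \<open>A z = (K\<^sup>* y, - K x)\<close>. Since \<open>A\<close> is
  skew, \<open>T e = G + A + e id\<close> is strongly monotone with modulus \<open>e\<close>. The saddle points of the Lagrangian
  are the zeros of \<open>T 0\<close>, the saddle point \<open>z\<^sub>t\<close> of the regularized function is the zero of \<open>T (\<epsilon> t)\<close>, and
  the system is \<open>z'' + \<alpha> z' + \<beta> (G z + A (z + \<theta> t z') + \<epsilon> z) = 0\<close>.

  Monotonicity gives three facts about \<open>z\<^sub>t\<close>: its norm is at most that of any saddle point, it tends to
  the saddle point of minimal norm as \<open>\<epsilon>\<close> tends to \<open>0\<close>, and
  \<open>norm (z\<^sub>s - z\<^sub>t) \<le> |\<epsilon> s - \<epsilon> t| / \<epsilon> s * norm z\<^sub>t\<close> (\<open>norm_zsol_le\<close>, \<open>zsol_tendsto\<close>, \<open>zsol_diff_le\<close>). The last one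
  makes \<open>z\<^sub>t\<close> locally Lipschitz, so it is differentiable almost everywhere by Lebesgue's theorem
  (\<open>lipschitz_vector_differentiable_AE\<close>), and bounds its speed by a multiple of \<open>|\<epsilon>'| / \<epsilon>\<close>. All
  coefficients of the perturbation \<open>P\<close> are bounded by a multiple of \<open>H\<close>, so \<open>\<R> \<le> c \<Psi>\<close> almost everywhere
  (\<open>residual_le\<close>). This settles the first two assertions.

  For the trajectories, let \<open>E(t)\<close> be the sum of \<open>\<theta>\<^sup>2 t\<^sup>2 \<beta>\<close> times the saddle gap between \<open>z(t)\<close> and \<open>z\<^sub>t\<close>,
  of half the square of \<open>norm (z - z\<^sub>t + \<theta> t z')\<close>, and of \<open>(\<theta> t \<alpha> - 1 - \<theta>) / 2\<close> times the square of
  \<open>norm (z - z\<^sub>t)\<close>. The skew cross terms cancel in the derivative of \<open>E\<close>. The assumptions on the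
  coefficients make the remaining terms dissipative in \<open>z - z\<^sub>t\<close> and \<open>z'\<close>, with weights \<open>l\<close> and \<open>\<Gamma>\<close>, up to
  terms caused by the motion of \<open>z\<^sub>t\<close>, and completing squares leaves \<open>E' \<le> c t\<^sup>2 \<Psi>\<close>. As \<open>z\<^sub>t\<close> is only
  locally Lipschitz, this inequality is proved for right derivatives of smooth majorants of \<open>E\<close>
  (\<open>energy_majorant\<close>) and integrated in that form (\<open>right_majorant_le_integral\<close>). By strong convexity \<open>E\<close> is
  at least \<open>\<theta>\<^sup>2 t\<^sup>2 \<beta> \<epsilon> / 2\<close> times the square of \<open>norm (z - z\<^sub>t)\<close> (\<open>energy_ge\<close>). Dividing by \<open>t\<^sup>2 \<beta> \<epsilon>\<close>, the
  assumption on \<open>\<Psi>\<close> gives \<open>z - z\<^sub>t \<longrightarrow> 0\<close>.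
\<close>

section \<open>Almost everywhere differentiability of Lipschitz functions\<close>

text \<open>The derivates of a function are measured on open intervals that contain the point, not only
  on intervals with the point as an end. The intervals supplied by \<open>P\<close> need not be centred at
  the point either, so the covering theorem is stated with end points.\<close>

lemma Vitali_covering_open_intervals:
  fixes P :: "real \<Rightarrow> real \<Rightarrow> bool"
  assumes "open U"
    and P: "\<And>x d. \<lbrakk>x \<in> S; 0 < d\<rbrakk> \<Longrightarrow> \<exists>u v. u < x \<and> x < v \<and> v - u < d \<and> P u v"
  obtains C where "countable C" "\<And>u v. (u, v) \<in> C \<Longrightarrow> u < v \<and> P u v \<and> {u<..<v} \<subseteq> U"
    "disjoint_family_on (\<lambda>(u, v). {u<..<v}) C"
    "negligible (S \<inter> U - (\<Union>(u, v)\<in>C. {u<..<v}))"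
proof -
  define K where "K = {(u, v). u < v \<and> P u v \<and> {u<..<v} \<subseteq> U}"
  define a where "a = (\<lambda>(u, v). (u + v) / 2 :: real)"
  define r where "r = (\<lambda>(u, v). (v - u) / 2 :: real)"
  have ball_eq: "ball (a i) (r i) = (case i of (u, v) \<Rightarrow> {u<..<v})" for i
  proof (cases i)
    case (Pair u v)
    have "(u + v) / 2 - (v - u) / 2 = u" "(u + v) / 2 + (v - u) / 2 = v"
      by (simp_all add: field_simps)
    then show ?thesis
      by (simp add: Pair a_def r_def ball_eq_greaterThanLessThan)
  qed
  have "\<exists>i. i \<in> K \<and> x \<in> ball (a i) (r i) \<and> r i < d" if x: "x \<in> S \<inter> U" and d: "0 < d" for x d
  proof -
    obtain e where e: "e > 0" "ball x e \<subseteq> U"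
      using \<open>open U\<close> x by (auto simp: open_contains_ball)
    obtain u v where uv: "u < x" "x < v" "v - u < min d e" "P u v"
      using P[of x "min d e"] x d e by auto
    have "{u<..<v} \<subseteq> ball x e"
      using uv by (auto simp: dist_real_def abs_if)
    then have "(u, v) \<in> K"
      using uv e by (auto simp: K_def)
    moreover have "x \<in> ball (a (u, v)) (r (u, v))"
      unfolding ball_eq using uv by simp
    moreover have "r (u, v) < d"
      using uv by (simp add: r_def)
    ultimately show ?thesis by blast
  qed
  from Vitali_covering_theorem_balls[OF this] obtain C where C: "countable C" "C \<subseteq> K"
     "pairwise (\<lambda>i j. disjnt (ball (a i) (r i)) (ball (a j) (r j))) C"
     "negligible (S \<inter> U - (\<Union>i \<in> C. ball (a i) (r i)))"
    by blast
  show thesis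
  proof
    show "countable C" by fact
    show "u < v \<and> P u v \<and> {u<..<v} \<subseteq> U" if "(u, v) \<in> C" for u v
      using that C(2) by (auto simp: K_def)
    show "disjoint_family_on (\<lambda>(u, v). {u<..<v}) C"
      using C(3) by (simp add: ball_eq pairwise_def disjoint_family_on_def disjnt_def)
    show "negligible (S \<inter> U - (\<Union>(u, v)\<in>C. {u<..<v}))"
      using C(4) by (simp add: ball_eq)
  qed
qed

lemma emeasure_interval_measure_Ioo:
  assumes "u \<le> v" and mono: "mono F" and cont: "continuous_on UNIV F"
  shows "emeasure (interval_measure F) {u<..<v} = ennreal (F v - F u)"
proof (cases "u = v")
  case False
  have Icc: "emeasure (interval_measure F) {a..b} = ennreal (F b - F a)" if "a \<le> b" for a b
    using emeasure_interval_measure_Icc[OF that _ cont] mono by (auto simp: mono_def)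
  have "emeasure (interval_measure F) {u} = 0" "emeasure (interval_measure F) {v} = 0"
    using Icc[of u u] Icc[of v v] by auto
  then have "{u, v} \<in> null_sets (interval_measure F)"
    using null_sets.Un[of "{u}" "interval_measure F" "{v}"] by (auto simp: null_sets_def insert_commute)
  then have "emeasure (interval_measure F) ({u..v} - {u, v}) = emeasure (interval_measure F) {u..v}"
    by (intro emeasure_Diff_null_set) auto
  moreover have "{u..v} - {u, v} = {u<..<v}"
    by auto
  ultimately show ?thesis
    using Icc[OF \<open>u \<le> v\<close>] by simp
qed simp

lemma emeasure_interval_measure_Union_le:
  assumes "mono F" "continuous_on UNIV F" "0 \<le> p" "countable C"
    and "disjoint_family_on (\<lambda>(u, v). {u<..<v}) C"
    and C: "\<And>u v. (u, v) \<in> C \<Longrightarrow> u < v \<and> F v - F u \<le> p * (v - u)"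
  shows "emeasure (interval_measure F) (\<Union>(u, v)\<in>C. {u<..<v})
         \<le> ennreal p * emeasure lborel (\<Union>(u, v)\<in>C. {u<..<v})"
proof -
  have "emeasure (interval_measure F) (\<Union>(u, v)\<in>C. {u<..<v}) =
    (\<integral>\<^sup>+i. emeasure (interval_measure F) (case i of (u, v) \<Rightarrow> {u<..<v}) \<partial>count_space C)"
    using assms by (intro emeasure_UN_countable) auto
  also have "\<dots> \<le> (\<integral>\<^sup>+i. ennreal p * emeasure lborel (case i of (u, v) \<Rightarrow> {u<..<v}) \<partial>count_space C)"
    using assms by (intro nn_integral_mono)
      (auto simp: emeasure_interval_measure_Ioo ennreal_mult[symmetric] less_imp_le intro!: ennreal_leI
        dest!: C)
  also have "\<dots> = ennreal p * (\<integral>\<^sup>+i. emeasure lborel (case i of (u, v) \<Rightarrow> {u<..<v}) \<partial>count_space C)"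
    by (intro nn_integral_cmult) auto
  also have "(\<integral>\<^sup>+i. emeasure lborel (case i of (u, v) \<Rightarrow> {u<..<v}) \<partial>count_space C) =
      emeasure lborel (\<Union>(u, v)\<in>C. {u<..<v})"
    using assms by (intro emeasure_UN_countable[symmetric]) auto
  finally show ?thesis .
qed

lemma emeasure_interval_measure_Union_ge:
  assumes "mono F" "continuous_on UNIV F" "0 \<le> q" "countable C"
    and "disjoint_family_on (\<lambda>(u, v). {u<..<v}) C"
    and C: "\<And>u v. (u, v) \<in> C \<Longrightarrow> u < v \<and> q * (v - u) \<le> F v - F u"
  shows "ennreal q * emeasure lborel (\<Union>(u, v)\<in>C. {u<..<v})
         \<le> emeasure (interval_measure F) (\<Union>(u, v)\<in>C. {u<..<v})"
proof -
  have "ennreal q * emeasure lborel (\<Union>(u, v)\<in>C. {u<..<v}) =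
    ennreal q * (\<integral>\<^sup>+i. emeasure lborel (case i of (u, v) \<Rightarrow> {u<..<v}) \<partial>count_space C)"
    using assms by (subst emeasure_UN_countable) auto
  also have "\<dots> = (\<integral>\<^sup>+i. ennreal q * emeasure lborel (case i of (u, v) \<Rightarrow> {u<..<v}) \<partial>count_space C)"
    by (intro nn_integral_cmult[symmetric]) auto
  also have "\<dots> \<le> (\<integral>\<^sup>+i. emeasure (interval_measure F) (case i of (u, v) \<Rightarrow> {u<..<v}) \<partial>count_space C)"
    using assms by (intro nn_integral_mono)
      (auto simp: emeasure_interval_measure_Ioo ennreal_mult[symmetric] less_imp_le intro!: ennreal_leI
        dest!: C)
  also have "\<dots> = emeasure (interval_measure F) (\<Union>(u, v)\<in>C. {u<..<v})"
    using assms by (intro emeasure_UN_countable[symmetric]) auto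
  finally show ?thesis .
qed

text \<open>The points that lie in arbitrarily short open intervals on which the difference quotient of
  \<open>F\<close> is below \<open>p\<close>: up to the boundary case, the lower derivate of \<open>F\<close> is below \<open>p\<close>. Because the
  point lies strictly inside the interval, each length bound gives an open set, and the whole is a
  Borel set for every \<open>F\<close>.\<close>

definition slope_below :: "(real \<Rightarrow> real) \<Rightarrow> real \<Rightarrow> real set" where
  "slope_below F p = {x. \<forall>d>0. \<exists>u v. u < x \<and> x < v \<and> v - u < d \<and> F v - F u < p * (v - u)}"

text \<open>The mirror image of \<^const>\<open>slope_below\<close>: difference quotients above \<open>q\<close>.\<close>

definition slope_above :: "(real \<Rightarrow> real) \<Rightarrow> real \<Rightarrow> real set" where
  "slope_above F q = {x. \<forall>d>0. \<exists>u v. u < x \<and> x < v \<and> v - u < d \<and> F v - F u > q * (v - u)}"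

lemma slope_above_eq: "slope_above F q = slope_below (\<lambda>x. - F x) (- q)"
proof -
  have "F v - F u > q * (v - u) \<longleftrightarrow> (- F v) - (- F u) < - q * (v - u)" for u v
    by auto
  then show ?thesis
    unfolding slope_above_def slope_below_def by simp
qed

lemma borel_slope_below: "slope_below F p \<in> sets borel"
proof -
  define B where "B n = (\<Union>(u, v)\<in>{(u, v). v - u < inverse (Suc n) \<and> F v - F u < p * (v - u)}. {u<..<v})"
    for n :: nat
  have "slope_below F p = (\<Inter>n. B n)"
  proof (intro set_eqI iffI)
    fix x assume x: "x \<in> slope_below F p"
    show "x \<in> (\<Inter>n. B n)"
    proof
      fix n
      have "\<exists>u v. u < x \<and> x < v \<and> v - u < inverse (real (Suc n)) \<and> F v - F u < p * (v - u)"
        using x unfolding slope_below_def by simp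
      then show "x \<in> B n"
        by (auto simp: B_def)
    qed
  next
    fix x assume x: "x \<in> (\<Inter>n. B n)"
    show "x \<in> slope_below F p"
      unfolding slope_below_def
    proof (intro CollectI allI impI)
      fix d :: real assume "d > 0"
      then obtain n where n: "inverse (real (Suc n)) < d"
        using reals_Archimedean by blast
      have "x \<in> B n"
        using x by blast
      then obtain u v where "v - u < inverse (Suc n)" "F v - F u < p * (v - u)" "u < x" "x < v"
        by (auto simp: B_def)
      then show "\<exists>u v. u < x \<and> x < v \<and> v - u < d \<and> F v - F u < p * (v - u)"
        using n by (intro exI[of _ u] exI[of _ v]) auto
    qed
  qed
  moreover have "open (B n)" for n
    unfolding B_def by (intro open_UN) auto
  ultimately show ?thesis
    by auto
qed

lemma borel_slope_above: "slope_above F q \<in> sets borel"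
  unfolding slope_above_eq by (rule borel_slope_below)

text \<open>On \<open>E\<close> the difference quotients come both below \<open>p\<close> and above \<open>q\<close>. Two Vitali coverings then
  compare the Lebesgue measure with the variation of \<open>F\<close>. Nearly all of \<open>E\<close> lies in an open set \<open>V\<close>, barely larger than \<open>E\<close>, whose
  variation is at most \<open>p\<close> times its length; inside \<open>V\<close>, nearly all of \<open>E\<close> lies in an open set \<open>W\<close> whose
  variation is at least \<open>q\<close> times its length. Hence \<open>q |E| \<le> p |E|\<close>, which forces \<open>|E| = 0\<close>.\<close>

lemma emeasure_slopes_eq_0:
  fixes F :: "real \<Rightarrow> real"
  assumes mono: "mono F" and cont: "continuous_on UNIV F" and pq: "0 \<le> p" "p < q"
    and E: "E \<subseteq> slope_below F p \<inter> slope_above F q" "E \<in> sets borel" "emeasure lborel E < \<infinity>"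
  shows "emeasure lborel E = 0"
proof -
  define m where "m = measure lborel E"
  have m: "emeasure lborel E = ennreal m"
    using E(3) unfolding m_def by (intro emeasure_eq_ennreal_measure) auto
  have "m \<ge> 0"
    by (simp add: m_def)
  have bound: "q * m \<le> p * (m + e)" if "e > 0" for e
  proof -
    obtain U where U: "open U" "E \<subseteq> U" "U - E \<in> lmeasurable" "emeasure lebesgue (U - E) < ennreal e"
      using sets_lebesgue_outer_open[of E e] E(2) \<open>e > 0\<close> by auto
    have "emeasure lborel U \<le> emeasure lborel E + emeasure lborel (U - E)"
      using U E(2) by (intro order_trans[OF _ emeasure_subadditive] emeasure_mono) auto
    also have "\<dots> \<le> ennreal m + ennreal e"
      using U E(2) m by (intro add_mono) auto
    finally have U_le: "emeasure lborel U \<le> ennreal (m + e)"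
      using \<open>m \<ge> 0\<close> \<open>e > 0\<close> by simp
    obtain C where C: "countable C" "disjoint_family_on (\<lambda>(u, v). {u<..<v}) C"
      "\<And>u v. (u, v) \<in> C \<Longrightarrow> u < v \<and> F v - F u < p * (v - u) \<and> {u<..<v} \<subseteq> U"
      "negligible (E \<inter> U - (\<Union>(u, v)\<in>C. {u<..<v}))"
    proof (rule Vitali_covering_open_intervals[OF U(1), of E "\<lambda>u v. F v - F u < p * (v - u)"])
      show "\<exists>u v. u < x \<and> x < v \<and> v - u < d \<and> F v - F u < p * (v - u)"
        if "x \<in> E" "0 < d" for x d
        using that E(1) by (auto simp: slope_below_def)
    qed blast
    define V where "V = (\<Union>(u, v)\<in>C. {u<..<v})"
    have V: "open V" "V \<subseteq> U"
      using C(3) by (auto simp: V_def)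
    obtain D where D: "countable D" "disjoint_family_on (\<lambda>(u, v). {u<..<v}) D"
      "\<And>u v. (u, v) \<in> D \<Longrightarrow> u < v \<and> F v - F u > q * (v - u) \<and> {u<..<v} \<subseteq> V"
      "negligible (E \<inter> V - (\<Union>(u, v)\<in>D. {u<..<v}))"
    proof (rule Vitali_covering_open_intervals[OF V(1), of E "\<lambda>u v. F v - F u > q * (v - u)"])
      show "\<exists>u v. u < x \<and> x < v \<and> v - u < d \<and> F v - F u > q * (v - u)"
        if "x \<in> E" "0 < d" for x d
        using that E(1) by (auto simp: slope_above_def)
    qed blast
    define W where "W = (\<Union>(u, v)\<in>D. {u<..<v})"
    have W: "open W" "W \<subseteq> V"
      using D(3) by (auto simp: W_def)
    have [measurable]: "V \<in> sets borel" "W \<in> sets borel" "U \<in> sets borel" "E \<in> sets borel"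
      using U V W E by auto
    have "negligible (E - W)"
      by (rule negligible_subset[OF negligible_Un[OF C(4) D(4)]])
        (use U(2) in \<open>auto simp: V_def W_def\<close>)
    then have "emeasure lborel (E - W) = 0"
      by (simp add: negligible_iff_null_sets null_sets_completion_iff null_sets_def)
    have "ennreal m \<le> emeasure lborel W + emeasure lborel (E - W)"
      unfolding m[symmetric] by (intro order_trans[OF _ emeasure_subadditive] emeasure_mono) auto
    then have "ennreal q * ennreal m \<le> ennreal q * emeasure lborel W"
      using \<open>emeasure lborel (E - W) = 0\<close> by (intro mult_left_mono) auto
    also have "\<dots> \<le> emeasure (interval_measure F) W"
      unfolding W_def using D pq
      by (intro emeasure_interval_measure_Union_ge[OF mono cont]) (auto simp: less_imp_le)
    also have "\<dots> \<le> emeasure (interval_measure F) V"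
      using W by (intro emeasure_mono) auto
    also have "\<dots> \<le> ennreal p * emeasure lborel V"
      unfolding V_def using C pq
      by (intro emeasure_interval_measure_Union_le[OF mono cont]) (auto simp: less_imp_le)
    also have "\<dots> \<le> ennreal p * emeasure lborel U"
      using V by (intro mult_left_mono emeasure_mono) auto
    also have "\<dots> \<le> ennreal p * ennreal (m + e)"
      using U_le by (rule mult_left_mono) auto
    finally have "ennreal (q * m) \<le> ennreal (p * (m + e))"
      using pq \<open>m \<ge> 0\<close> \<open>e > 0\<close> by (simp add: ennreal_mult)
    then show ?thesis
      using pq \<open>m \<ge> 0\<close> \<open>e > 0\<close> by simp
  qed
  have "(q - p) * m \<le> 0"
  proof (rule field_le_epsilon)
    fix e :: real assume "e > 0"
    then have "q * m \<le> p * (m + e / (p + 1))" and "p / (p + 1) * e \<le> 1 * e"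
      using pq by (intro bound mult_right_mono; simp)+
    then show "(q - p) * m \<le> 0 + e"
      by (simp add: algebra_simps)
  qed
  then have "m = 0"
    using pq \<open>m \<ge> 0\<close> by (simp add: mult_le_0_iff)
  then show ?thesis
    using m by simp
qed

lemma negligible_slopes:
  fixes F :: "real \<Rightarrow> real"
  assumes mono: "mono F" and cont: "continuous_on UNIV F" and pq: "0 \<le> p" "p < q"
  shows "negligible (slope_below F p \<inter> slope_above F q)"
proof -
  let ?E = "slope_below F p \<inter> slope_above F q"
  have "negligible (?E \<inter> {- real n..real n})" for n
  proof -
    have s: "?E \<inter> {- real n..real n} \<in> sets borel"
      using borel_slope_below borel_slope_above by auto
    have "emeasure lborel (?E \<inter> {- real n..real n}) \<le> emeasure lborel {- real n..real n}"
      by (intro emeasure_mono) auto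
    also have "\<dots> < \<infinity>"
      by simp
    finally have "emeasure lborel (?E \<inter> {- real n..real n}) = 0"
      using s by (intro emeasure_slopes_eq_0[OF mono cont pq]) auto
    then show ?thesis
      using s by (simp add: negligible_iff_null_sets null_sets_completion_iff null_sets_def)
  qed
  then have "negligible (\<Union>n. ?E \<inter> {- real n..real n})"
    by (intro negligible_countable_Union) auto
  moreover have "(\<Union>n. ?E \<inter> {- real n..real n}) = ?E"
  proof -
    have "\<exists>n. x \<in> {- real n..real n}" for x :: real
      using real_arch_simple[of "\<bar>x\<bar>"] by (force simp: abs_le_iff)
    then show ?thesis by blast
  qed
  ultimately show ?thesis
    by simp
qed

text \<open>Letting the free end of an interval tend to \<open>x\<close> turns bounds on the quotients over intervals
  around \<open>x\<close> into bounds on the quotients with one end at \<open>x\<close>.\<close>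

lemma slope_ge_eventually:
  assumes cont: "continuous_on UNIV F" and x: "x \<notin> slope_below F p"
  shows "eventually (\<lambda>y. p \<le> (F y - F x) / (y - x)) (at x)"
proof -
  obtain d where d0: "d > 0" "\<not> (\<exists>u v. u < x \<and> x < v \<and> v - u < d \<and> F v - F u < p * (v - u))"
    using x unfolding slope_below_def by blast
  have d: "d > 0" "\<And>u v. \<lbrakk>u < x; x < v; v - u < d\<rbrakk> \<Longrightarrow> p * (v - u) \<le> F v - F u"
    using d0 by (meson not_less)+
  have lim: "(F \<longlongrightarrow> F x) (at x within S)" for S
    using cont by (auto simp: continuous_on_def intro: tendsto_within_subset)
  have "p \<le> (F y - F x) / (y - x)" if y: "y \<noteq> x" "dist y x < d" for y
  proof (cases "x < y")
    case True
    have "p * (y - x) \<le> F y - F x"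
    proof (rule tendsto_le)
      show "((\<lambda>u. F y - F u) \<longlongrightarrow> F y - F x) (at_left x)"
        by (intro tendsto_intros lim)
      show "((\<lambda>u. p * (y - u)) \<longlongrightarrow> p * (y - x)) (at_left x)"
        by (intro tendsto_intros)
      show "eventually (\<lambda>u. p * (y - u) \<le> F y - F u) (at_left x)"
        unfolding eventually_at_left_field
        using True y d by (intro exI[of _ "y - d"]) (auto simp: dist_real_def)
    qed simp
    then show ?thesis
      using True by (simp add: field_simps)
  next
    case False
    then have "y < x"
      using y by simp
    have "p * (x - y) \<le> F x - F y"
    proof (rule tendsto_le)
      show "((\<lambda>v. F v - F y) \<longlongrightarrow> F x - F y) (at_right x)"
        by (intro tendsto_intros lim)
      show "((\<lambda>v. p * (v - y)) \<longlongrightarrow> p * (x - y)) (at_right x)"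
        by (intro tendsto_intros)
      show "eventually (\<lambda>v. p * (v - y) \<le> F v - F y) (at_right x)"
        unfolding eventually_at_right_field
        using \<open>y < x\<close> y d by (intro exI[of _ "y + d"]) (auto simp: dist_real_def)
    qed simp
    then show ?thesis
      using \<open>y < x\<close> by (simp add: field_simps)
  qed
  then show ?thesis
    unfolding eventually_at using d(1) by blast
qed

lemma slope_le_eventually:
  assumes cont: "continuous_on UNIV F" and x: "x \<notin> slope_above F q"
  shows "eventually (\<lambda>y. (F y - F x) / (y - x) \<le> q) (at x)"
proof -
  have "eventually (\<lambda>y. - q \<le> (- F y - - F x) / (y - x)) (at x)"
    using x by (intro slope_ge_eventually) (auto simp: slope_above_eq intro: continuous_on_minus cont)
  then show ?thesis
  proof eventually_elim
    case (elim y)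
    have "(- F y - - F x) / (y - x) = - ((F y - F x) / (y - x))"
      by (simp add: divide_simps)
    then show ?case
      using elim by linarith
  qed
qed

lemma slope_below_mono:
  assumes "p \<le> p'" shows "slope_below F p \<subseteq> slope_below F p'"
proof
  fix x assume x: "x \<in> slope_below F p"
  show "x \<in> slope_below F p'"
    unfolding slope_below_def
  proof (intro CollectI allI impI)
    fix d :: real assume "d > 0"
    then obtain u v where uv: "u < x" "x < v" "v - u < d" "F v - F u < p * (v - u)"
      using x unfolding slope_below_def by blast
    moreover have "p * (v - u) \<le> p' * (v - u)"
      using assms uv by (intro mult_right_mono) auto
    ultimately show "\<exists>u v. u < x \<and> x < v \<and> v - u < d \<and> F v - F u < p' * (v - u)"
      by (meson less_le_trans)
  qed
qed

text \<open>Away from the null set on which a rational pair \<open>p < q\<close> separates the derivates, the infimum of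
  the slopes \<open>p\<close> with \<open>x \<in> slope_below F p\<close> is the derivative.\<close>

lemma mono_lipschitz_differentiable_AE:
  fixes F :: "real \<Rightarrow> real"
  assumes mono: "mono F" and lip: "L-lipschitz_on UNIV F"
  obtains N where "negligible N" "\<And>x. x \<notin> N \<Longrightarrow> F field_differentiable (at x)"
proof
  define N where "N = (\<Union>(p, q)\<in>{(p, q). p \<in> \<rat> \<and> q \<in> \<rat> \<and> 0 \<le> p \<and> p < q}. slope_below F p \<inter> slope_above F q)"
  have cont: "continuous_on UNIV F"
    using lip by (rule lipschitz_on_continuous_on)
  have "countable {(p :: real, q :: real). p \<in> \<rat> \<and> q \<in> \<rat> \<and> 0 \<le> p \<and> p < q}"
    by (rule countable_subset[of _ "\<rat> \<times> \<rat>"]) (auto intro: countable_rat)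
  then show "negligible N"
    unfolding N_def using negligible_slopes[OF mono cont]
    by (intro negligible_countable_Union countable_image) auto
  fix x assume x: "x \<notin> N"
  define S where "S = {p. x \<in> slope_below F p}"
  have nonneg: "0 \<le> p" if "p \<in> S" for p
  proof -
    have "\<exists>u v. u < x \<and> x < v \<and> v - u < 1 \<and> F v - F u < p * (v - u)"
      using that unfolding S_def slope_below_def by simp
    then obtain u v where "u < v" "F v - F u < p * (v - u)"
      using less_trans by blast
    moreover have "F u \<le> F v"
      using mono \<open>u < v\<close> by (simp add: mono_def)
    ultimately have "0 < p * (v - u)" "0 < v - u"
      by linarith+
    then show ?thesis
      by (simp add: zero_less_mult_iff)
  qed
  have "L + 1 \<in> S"
    unfolding S_def slope_below_def
  proof (intro CollectI allI impI)
    fix d :: real assume "d > 0"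
    have "\<bar>F (x + d / 3) - F (x - d / 3)\<bar> \<le> L * (2 * d / 3)"
      using lipschitz_onD[OF lip, of "x + d / 3" "x - d / 3"] \<open>d > 0\<close> by (simp add: dist_real_def)
    then have "F (x + d / 3) - F (x - d / 3) \<le> L * (2 * d / 3)"
      by linarith
    then show "\<exists>u v. u < x \<and> x < v \<and> v - u < d \<and> F v - F u < (L + 1) * (v - u)"
      using \<open>d > 0\<close> by (intro exI[of _ "x - d / 3"] exI[of _ "x + d / 3"]) (auto simp: algebra_simps)
  qed
  define D where "D = Inf S"
  have bdd: "bdd_below S"
    using nonneg by (rule bdd_belowI)
  have lower: "eventually (\<lambda>y. D - e \<le> (F y - F x) / (y - x)) (at x)" if "e > 0" for e
  proof (intro slope_ge_eventually[OF cont] notI)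
    assume "x \<in> slope_below F (D - e)"
    then have "D \<le> D - e"
      unfolding D_def S_def[symmetric] by (intro cInf_lower bdd) (auto simp: S_def)
    then show False
      using \<open>e > 0\<close> by simp
  qed
  have upper: "eventually (\<lambda>y. (F y - F x) / (y - x) \<le> D + e) (at x)" if "e > 0" for e
  proof -
    obtain p where p: "p \<in> S" "p < D + e"
      using cInf_lessD[of S "D + e"] \<open>L + 1 \<in> S\<close> \<open>e > 0\<close> unfolding D_def by auto
    obtain p1 where p1: "p1 \<in> \<rat>" "p < p1" "p1 < D + e"
      using Rats_dense_in_real p(2) by blast
    obtain q1 where q1: "q1 \<in> \<rat>" "p1 < q1" "q1 < D + e"
      using Rats_dense_in_real p1(3) by blast
    have "x \<in> slope_below F p1"
      using slope_below_mono[of p p1 F] p p1 by (auto simp: S_def)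
    then have "x \<notin> slope_above F q1"
      using x p1 q1 nonneg[OF p(1)] by (auto simp: N_def)
    then show ?thesis
      by (rule eventually_mono[OF slope_le_eventually[OF cont]]) (use q1(3) in auto)
  qed
  have "((\<lambda>y. (F y - F x) / (y - x)) \<longlongrightarrow> D) (at x)"
  proof (rule tendstoI)
    fix e :: real assume "e > 0"
    have "e / 2 > 0"
      using \<open>e > 0\<close> by simp
    from lower[OF this] upper[OF this]
    show "eventually (\<lambda>y. dist ((F y - F x) / (y - x)) D < e) (at x)"
      proof eventually_elim
      case (elim y)
      then show ?case
        using \<open>e > 0\<close> unfolding dist_real_def by linarith
    qed
  qed
  then have "(F has_field_derivative D) (at x)"
    by (simp add: has_field_derivative_iff)
  then show "F field_differentiable (at x)"
    by (auto simp: field_differentiable_def)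
qed

theorem lipschitz_vector_differentiable_AE:
  fixes F :: "real \<Rightarrow> 'a::euclidean_space"
  assumes lip: "L-lipschitz_on UNIV F"
  obtains N where "negligible N" "\<And>x. x \<notin> N \<Longrightarrow> F differentiable (at x)"
proof -
  have "\<exists>N. negligible N \<and> (\<forall>x. x \<notin> N \<longrightarrow> (\<lambda>x. F x \<bullet> b) differentiable (at x))" if "b \<in> Basis" for b
  proof -
    \<comment> \<open>The linear term makes the component nondecreasing.\<close>
    define h where "h x = F x \<bullet> b + L * x" for x
    have "L \<ge> 0"
      using lip by (rule lipschitz_on_nonneg)
    have Lb: "\<bar>F x \<bullet> b - F y \<bullet> b\<bar> \<le> L * \<bar>x - y\<bar>" for x y
      using Basis_le_norm[OF that, of "F x - F y"] lipschitz_onD[OF lip, of x y]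
      by (simp add: inner_diff_left dist_norm)
    have "mono h"
    proof (rule monoI)
      fix x y :: real assume "x \<le> y"
      then show "h x \<le> h y"
        using Lb[of x y] by (auto simp: h_def abs_if algebra_simps split: if_splits)
    qed
    moreover have "(L + L)-lipschitz_on UNIV h"
    proof (rule lipschitz_onI)
      fix x y :: real
      have "\<bar>h x - h y\<bar> \<le> \<bar>F x \<bullet> b - F y \<bullet> b\<bar> + \<bar>L * (x - y)\<bar>"
        by (simp add: h_def algebra_simps)
      also have "\<dots> \<le> (L + L) * \<bar>x - y\<bar>"
        using Lb[of x y] \<open>L \<ge> 0\<close> unfolding abs_mult by (simp add: ring_distribs)
      finally show "dist (h x) (h y) \<le> (L + L) * dist x y"
        by (simp add: dist_real_def)
    qed (use \<open>L \<ge> 0\<close> in auto)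
    ultimately obtain N where N: "negligible N" "\<And>x. x \<notin> N \<Longrightarrow> h field_differentiable (at x)"
      using mono_lipschitz_differentiable_AE by blast
    have "(\<lambda>x. F x \<bullet> b) differentiable (at x)" if "x \<notin> N" for x
    proof -
      have "(\<lambda>x. h x - L * x) differentiable (at x)"
        using N(2)[OF that] by (intro differentiable_diff field_differentiable_imp_differentiable) auto
      then show ?thesis
        by (simp add: h_def)
    qed
    then show ?thesis
      using N(1) by blast
  qed
  then obtain N where N: "\<And>b. b \<in> Basis \<Longrightarrow> negligible (N b)"
    "\<And>b x. b \<in> Basis \<Longrightarrow> x \<notin> N b \<Longrightarrow> (\<lambda>x. F x \<bullet> b) differentiable (at x)"
    by metis
  show thesis
  proof
    show "negligible (\<Union>b\<in>Basis. N b)"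
      using N(1) by (intro negligible_Union) auto
    show "F differentiable (at x)" if "x \<notin> (\<Union>b\<in>Basis. N b)" for x
      using that N(2) by (subst differentiable_componentwise_within) auto
  qed
qed

section \<open>Regularized zeros of a monotone operator\<close>

lemma convex_gradient_inequality:
  fixes \<phi> :: "'a::euclidean_space \<Rightarrow> real"
  assumes convex: "convex_on UNIV \<phi>" and grad: "GDERIV \<phi> z :> g"
  shows "\<phi> w \<ge> \<phi> z + g \<bullet> (w - z)"
proof -
  define h where "h t = \<phi> (z + t *\<^sub>R (w - z))" for t
  have "convex_on UNIV h"
  proof (rule convex_onI)
    fix t x y :: real assume "0 < t" "t < 1"
    have "z + ((1 - t) *\<^sub>R x + t *\<^sub>R y) *\<^sub>R (w - z) =
       (1 - t) *\<^sub>R (z + x *\<^sub>R (w - z)) + t *\<^sub>R (z + y *\<^sub>R (w - z))"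
      by (simp add: algebra_simps)
    then show "h ((1 - t) *\<^sub>R x + t *\<^sub>R y) \<le> (1 - t) * h x + t * h y"
      unfolding h_def using convex_onD[OF convex, of t "z + x *\<^sub>R (w - z)" "z + y *\<^sub>R (w - z)"] \<open>0 < t\<close> \<open>t < 1\<close>
      by simp
  qed simp
  moreover have "(h has_real_derivative g \<bullet> (w - z)) (at 0)"
  proof -
    have "(\<phi> has_derivative (\<lambda>v. v \<bullet> g)) (at (z + 0 *\<^sub>R (w - z)))"
      using grad by (simp add: gderiv_def inner_commute)
    then have "((\<lambda>t. \<phi> (z + t *\<^sub>R (w - z))) has_derivative (\<lambda>s. (s *\<^sub>R (w - z)) \<bullet> g)) (at 0)"
      by (rule has_derivative_compose[rotated]) (auto intro!: derivative_eq_intros)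
    moreover have "(\<lambda>s. (s *\<^sub>R (w - z)) \<bullet> g) = (*) (g \<bullet> (w - z))"
      by (simp add: fun_eq_iff inner_commute)
    ultimately show ?thesis
      by (simp only: h_def[abs_def] has_field_derivative_def)
  qed
  ultimately have "h 1 - h 0 \<ge> (g \<bullet> (w - z)) * (1 - 0)"
    by (intro convex_on_imp_above_tangent[where A = UNIV]) auto
  then show ?thesis
    by (simp add: h_def)
qed

text \<open>The saddle function is encoded on the product space: for \<open>f(x) + \<langle>K x, y\<rangle> - g(y)\<close> take
  \<open>\<phi> (x, y) = f x + g y\<close> with gradient \<open>G\<close>, and the skew operator \<open>A (x, y) = (K\<^sup>* y, - K x)\<close>. Then
  \<open>G + A\<close> is a monotone operator and its zeros are the saddle points.\<close>

locale regularized_saddle =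
  fixes \<phi> :: "'a::euclidean_space \<Rightarrow> real" and G A :: "'a \<Rightarrow> 'a" and M :: real
  assumes convex: "convex_on UNIV \<phi>" and grad: "GDERIV \<phi> z :> G z"
    and lip: "M-lipschitz_on UNIV G"
    and lin: "bounded_linear A" and skew: "A z \<bullet> z = 0"
begin

text \<open>The operator whose zeros are the saddle points of the function regularized with parameter
  \<open>e\<close>.\<close>

definition T :: "real \<Rightarrow> 'a \<Rightarrow> 'a" where
  "T e z = G z + A z + e *\<^sub>R z"

text \<open>The saddle gap: in terms of the regularized Lagrangian it is
  \<open>L\<^sub>e (x, \<eta>) - L\<^sub>e (\<xi>, y)\<close> for \<open>\<zeta> = (\<xi>, \<eta>)\<close> and \<open>z = (x, y)\<close>.\<close>

definition gap :: "real \<Rightarrow> 'a \<Rightarrow> 'a \<Rightarrow> real" where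
  "gap e \<zeta> z = \<phi> z - \<phi> \<zeta> + A \<zeta> \<bullet> z + e / 2 * ((norm z)\<^sup>2 - (norm \<zeta>)\<^sup>2)"

text \<open>The zero of \<^term>\<open>T e\<close>; it is unique, hence meaningful, for \<open>e > 0\<close>.\<close>

definition zsol :: "real \<Rightarrow> 'a" where
  "zsol e = (THE z. T e z = 0)"

lemma skew_commute: "A z \<bullet> w = - (A w \<bullet> z)"
proof -
  have "A (z + w) \<bullet> (z + w) = 0"
    by (rule skew)
  then show ?thesis
    by (simp add: bounded_linear.linear[OF lin] linear_add inner_add_left inner_add_right skew)
qed

lemma A_diff: "A (z - w) = A z - A w"
  by (rule linear_diff[OF bounded_linear.linear[OF lin]])

lemma A_add: "A (z + w) = A z + A w"
  by (rule linear_add[OF bounded_linear.linear[OF lin]])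

lemma gradient_inequality: "\<phi> w \<ge> \<phi> z + G z \<bullet> (w - z)"
  by (rule convex_gradient_inequality[OF convex grad])

lemma T_strongly_monotone: "(T e z - T e w) \<bullet> (z - w) \<ge> e * (norm (z - w))\<^sup>2"
proof -
  have "(G z - G w) \<bullet> (z - w) \<ge> 0"
    using gradient_inequality[of z w] gradient_inequality[of w z]
    unfolding inner_diff_left inner_diff_right by linarith
  moreover have "(A z - A w) \<bullet> (z - w) = 0"
    unfolding A_diff[symmetric] by (rule skew)
  moreover have "T e z - T e w = (G z - G w) + (A z - A w) + e *\<^sub>R (z - w)"
    by (simp add: T_def algebra_simps)
  ultimately show ?thesis
    by (simp add: inner_add_left power2_norm_eq_inner)
qed

lemma T_diff: "T e z - T e' z = (e - e') *\<^sub>R z"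
  by (simp add: T_def algebra_simps)

lemma T_lipschitz:
  obtains B where "B > 0" "\<And>z w. norm (T e z - T e w) \<le> B * norm (z - w)"
proof
  define B where "B = 1 + M + onorm A + \<bar>e\<bar>"
  show "B > 0"
    using lipschitz_on_nonneg[OF lip] onorm_pos_le[OF lin] by (simp add: B_def)
  fix z w
  have "norm (T e z - T e w) = norm ((G z - G w) + A (z - w) + e *\<^sub>R (z - w))"
    by (simp add: T_def A_diff algebra_simps)
  also have "\<dots> \<le> norm (G z - G w) + norm (A (z - w)) + norm (e *\<^sub>R (z - w))"
    by (intro norm_triangle_mono order_refl)
  also have "\<dots> \<le> M * norm (z - w) + onorm A * norm (z - w) + \<bar>e\<bar> * norm (z - w)"
    using lipschitz_onD[OF lip, of z w] onorm[OF lin, of "z - w"] by (simp add: dist_norm)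
  also have "\<dots> \<le> B * norm (z - w)"
    by (simp add: B_def algebra_simps)
  finally show "norm (T e z - T e w) \<le> B * norm (z - w)" .
qed

lemma T_zero_ex1:
  assumes "e > 0"
  shows "\<exists>!z. T e z = 0"
proof -
  obtain B where B: "B > 0" "\<And>z w. norm (T e z - T e w) \<le> B * norm (z - w)"
    using T_lipschitz by blast
  define C where "C = max B e"
  have C: "C > 0" "C \<ge> e"
    using B(1) by (auto simp: C_def)
  have C_lip: "norm (T e z - T e w) \<le> C * norm (z - w)" for z w
    by (rule order_trans[OF B(2)]) (simp add: C_def mult_right_mono)
  \<comment> \<open>The step length that minimizes the contraction bound \<open>1 - 2 r e + r\<^sup>2 C\<^sup>2\<close> found below.\<close>
  define r where "r = e / C\<^sup>2"
  define c where "c = sqrt (1 - e\<^sup>2 / C\<^sup>2)"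
  have r: "r > 0"
    using C \<open>e > 0\<close> by (simp add: r_def)
  have "e\<^sup>2 \<le> C\<^sup>2"
    using C \<open>e > 0\<close> by (intro power_mono) auto
  then have c0: "0 \<le> 1 - e\<^sup>2 / C\<^sup>2"
    using C(1) by (simp add: field_simps)
  have c: "0 \<le> c" "c < 1" "c\<^sup>2 = 1 - e\<^sup>2 / C\<^sup>2"
    using c0 C(1) \<open>e > 0\<close> by (auto simp: c_def)
  have "\<exists>!z. z - r *\<^sub>R T e z = z"
  proof (rule banach_fix_type[OF c(1,2)], intro allI)
    fix z w
    let ?d = "z - w" and ?t = "T e z - T e w"
    have "(norm (?d - r *\<^sub>R ?t))\<^sup>2 = (norm ?d)\<^sup>2 - 2 * r * (?t \<bullet> ?d) + r\<^sup>2 * (norm ?t)\<^sup>2"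
      unfolding power2_norm_eq_inner
      by (simp add: inner_diff_left inner_diff_right inner_commute power2_eq_square algebra_simps)
    also have "\<dots> \<le> (norm ?d)\<^sup>2 - 2 * r * (e * (norm ?d)\<^sup>2) + r\<^sup>2 * (C * norm ?d)\<^sup>2"
      using r T_strongly_monotone[of e z w] C_lip[of z w]
      by (intro add_mono diff_mono mult_left_mono power_mono) auto
    also have "\<dots> = (1 - 2 * r * e + r\<^sup>2 * C\<^sup>2) * (norm ?d)\<^sup>2"
      by (simp add: algebra_simps)
    also have "1 - 2 * r * e + r\<^sup>2 * C\<^sup>2 = c\<^sup>2"
      using C(1) unfolding c r_def by (simp add: field_simps power2_eq_square)
    finally have "(norm (?d - r *\<^sub>R ?t))\<^sup>2 \<le> (c * norm ?d)\<^sup>2"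
      by (simp add: power_mult_distrib)
    then have "norm (?d - r *\<^sub>R ?t) \<le> c * norm ?d"
      by (rule power2_le_imp_le) (simp add: c(1))
    then show "dist (z - r *\<^sub>R T e z) (w - r *\<^sub>R T e w) \<le> c * dist z w"
      by (simp add: dist_norm algebra_simps)
  qed
  then show ?thesis
    using r by simp
qed

lemma T_zsol: "e > 0 \<Longrightarrow> T e (zsol e) = 0"
  unfolding zsol_def using theI'[OF T_zero_ex1] .

lemma zsol_diff_le:
  assumes "e > 0" "e' > 0"
  shows "norm (zsol e' - zsol e) \<le> \<bar>e - e'\<bar> / e' * norm (zsol e)"
proof -
  let ?d = "zsol e' - zsol e"
  have "T e' (zsol e') - T e' (zsol e) = (e - e') *\<^sub>R zsol e"
    using T_zsol assms T_diff[of e "zsol e" e'] by (simp add: algebra_simps)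
  then have "e' * (norm ?d)\<^sup>2 \<le> (e - e') * (zsol e \<bullet> ?d)"
    using T_strongly_monotone[of e' "zsol e'" "zsol e"] by simp
  also have "\<dots> \<le> \<bar>e - e'\<bar> * \<bar>zsol e \<bullet> ?d\<bar>"
    unfolding abs_mult[symmetric] by (rule abs_ge_self)
  also have "\<dots> \<le> \<bar>e - e'\<bar> * (norm (zsol e) * norm ?d)"
    by (intro mult_left_mono Cauchy_Schwarz_ineq2) simp
  finally have "(e' * norm ?d) * norm ?d \<le> (\<bar>e - e'\<bar> * norm (zsol e)) * norm ?d"
    by (simp add: power2_eq_square mult.assoc)
  then have "e' * norm ?d \<le> \<bar>e - e'\<bar> * norm (zsol e)"
    by (cases "norm ?d = 0") (auto dest: mult_right_le_imp_le)
  then show ?thesis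
    using assms by (simp add: field_simps)
qed

lemma norm_zsol_le:
  assumes "e > 0" "T 0 p = 0"
  shows "norm (zsol e) \<le> norm p"
proof -
  let ?z = "zsol e"
  have "T 0 ?z - T 0 p = - (e *\<^sub>R ?z)"
    using T_zsol[OF assms(1)] T_diff[of 0 ?z e] assms(2) by simp
  then have "e * (?z \<bullet> (?z - p)) \<le> 0"
    using T_strongly_monotone[of 0 ?z p] by simp
  then have "?z \<bullet> ?z \<le> ?z \<bullet> p"
    using assms(1) by (simp add: mult_le_0_iff inner_diff_right)
  also have "\<dots> \<le> norm ?z * norm p"
    by (rule norm_cauchy_schwarz)
  finally have "norm ?z * norm ?z \<le> norm ?z * norm p"
    by (simp add: power2_norm_eq_inner[symmetric] power2_eq_square)
  then show ?thesis
    by (cases "norm ?z = 0") auto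
qed

lemma continuous_T: "continuous_on UNIV (T e)"
  unfolding T_def
  by (intro continuous_on_add continuous_on_scaleR continuous_on_const continuous_on_id
      lipschitz_on_continuous_on[OF lip] linear_continuous_on[OF lin])

text \<open>By assumption \<open>p\<close> is the only zero of norm at most \<open>norm p\<close>, so it is the only cluster point of the
  bounded family \<^const>\<open>zsol\<close> as the parameter decreases to \<open>0\<close>.\<close>

lemma zsol_tendsto:
  assumes p: "T 0 p = 0" and p_min: "\<And>q. T 0 q = 0 \<Longrightarrow> norm q \<le> norm p \<Longrightarrow> q = p"
  shows "(zsol \<longlongrightarrow> p) (at_right 0)"
proof (rule ccontr)
  assume "\<not> ?thesis"
  then obtain d where d: "d > 0" "\<not> eventually (\<lambda>e. dist (zsol e) p < d) (at_right 0)"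
    unfolding tendsto_iff by blast
  have "\<exists>e. 0 < e \<and> e < inverse (Suc n) \<and> d \<le> dist (zsol e) p" for n
  proof (rule ccontr)
    assume "\<not> ?thesis"
    then have "\<forall>e>0. e < inverse (Suc n) \<longrightarrow> dist (zsol e) p < d"
      by (meson not_less)
    then have "eventually (\<lambda>e. dist (zsol e) p < d) (at_right 0)"
      unfolding eventually_at_right_field by (intro exI[of _ "inverse (Suc n)"]) auto
    then show False
      using d(2) by simp
  qed
  then obtain e where e: "\<And>n. 0 < e n" "\<And>n. e n < inverse (Suc n)" "\<And>n. d \<le> dist (zsol (e n)) p"
    by metis
  have e_lim: "e \<longlonglongrightarrow> 0"
    by (rule real_tendsto_sandwich[OF _ _ tendsto_const LIMSEQ_inverse_real_of_nat])
      (use e in \<open>auto intro!: always_eventually less_imp_le\<close>)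
  have "zsol (e n) \<in> cball 0 (norm p)" for n
    using norm_zsol_le[OF e(1) p] by simp
  then obtain q and r :: "nat \<Rightarrow> nat" where q: "q \<in> cball 0 (norm p)" "strict_mono r"
    "((\<lambda>n. zsol (e n)) \<circ> r) \<longlonglongrightarrow> q"
    using seq_compactE[OF compact_imp_seq_compact[OF compact_cball], of "\<lambda>n. zsol (e n)" 0 "norm p"]
    by blast
  have er: "(\<lambda>n. e (r n)) \<longlonglongrightarrow> 0"
    using LIMSEQ_subseq_LIMSEQ[OF e_lim q(2)] by (simp add: o_def)
  have "(\<lambda>n. T 0 (zsol (e (r n)))) \<longlonglongrightarrow> T 0 q"
    using continuous_on_tendsto_compose[OF continuous_T q(3)] by (simp add: o_def)
  moreover have "T 0 (zsol (e (r n))) = - (e (r n) *\<^sub>R zsol (e (r n)))" for n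
    using T_zsol[OF e(1)] T_diff[of 0 "zsol (e (r n))" "e (r n)"] by simp
  moreover have "(\<lambda>n. - (e (r n) *\<^sub>R zsol (e (r n)))) \<longlonglongrightarrow> - (0 *\<^sub>R q)"
    using q(3) by (intro tendsto_intros er) (simp add: o_def)
  ultimately have "T 0 q = 0"
    using LIMSEQ_unique by fastforce
  then have "q = p"
    using q(1) by (intro p_min) auto
  moreover have "(\<lambda>n. dist (zsol (e (r n))) p) \<longlonglongrightarrow> dist q p"
    using q(3) by (intro tendsto_intros) (simp add: o_def)
  then have "d \<le> dist q p"
    by (rule LIMSEQ_le_const) (use e(3) in auto)
  ultimately show False
    using d(1) by simp
qed

lemma gap_zero_ge:
  assumes "T e \<zeta> = 0"
  shows "gap e \<zeta> z \<ge> e / 2 * (norm (z - \<zeta>))\<^sup>2"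
proof -
  have "T e \<zeta> \<bullet> (z - \<zeta>) = 0"
    using assms by simp
  then have "G \<zeta> \<bullet> (z - \<zeta>) + A \<zeta> \<bullet> z + e * (\<zeta> \<bullet> (z - \<zeta>)) = 0"
    using skew[of \<zeta>] unfolding T_def inner_add_left inner_scaleR_left inner_diff_right[of "A \<zeta>"] by simp
  then show ?thesis
    using gradient_inequality[of \<zeta> z] unfolding gap_def power2_norm_eq_inner
    by (simp add: inner_diff_left inner_diff_right inner_commute field_simps)
qed

lemma gap_nonneg_iff:
  assumes "e \<ge> 0"
  shows "(\<forall>z. gap e \<zeta> z \<ge> 0) \<longleftrightarrow> T e \<zeta> = 0"
proof
  assume "T e \<zeta> = 0"
  then show "\<forall>z. gap e \<zeta> z \<ge> 0"
    using gap_zero_ge assms by (meson order_trans mult_nonneg_nonneg zero_le_power2 divide_nonneg_pos zero_less_numeral)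
next
  assume nonneg: "\<forall>z. gap e \<zeta> z \<ge> 0"
  have "gap e \<zeta> \<zeta> = 0"
    using skew[of \<zeta>] by (simp add: gap_def)
  have *: "(\<phi> has_derivative (\<lambda>h. h \<bullet> G \<zeta>)) (at \<zeta>)"
    using grad[of \<zeta>] by (simp add: gderiv_def inner_commute)
  have "((\<lambda>z. \<phi> z - \<phi> \<zeta> + A \<zeta> \<bullet> z + e / 2 * (z \<bullet> z - \<zeta> \<bullet> \<zeta>))
         has_derivative (\<lambda>h. h \<bullet> T e \<zeta>)) (at \<zeta>)"
    by (rule derivative_eq_intros refl * | simp add: T_def algebra_simps inner_commute)+
  then have "(gap e \<zeta> has_derivative (\<lambda>h. h \<bullet> T e \<zeta>)) (at \<zeta>)"
    by (simp add: gap_def[abs_def] power2_norm_eq_inner)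
  then have "(\<lambda>h. h \<bullet> T e \<zeta>) = (\<lambda>h. 0)"
    using nonneg \<open>gap e \<zeta> \<zeta> = 0\<close>
    by (intro has_derivative_local_min) (auto intro!: always_eventually)
  then have "T e \<zeta> \<bullet> T e \<zeta> = 0"
    by meson
  then show "T e \<zeta> = 0"
    by simp
qed

text \<open>The gap is concave in its first argument, and the right-hand side is its linearization at
  \<open>\<zeta>\<close>.\<close>

lemma gap_change_le:
  assumes "e \<ge> 0"
  shows "gap e \<zeta>' z \<le> gap e \<zeta> z - (T e \<zeta> + A (z - \<zeta>)) \<bullet> (\<zeta>' - \<zeta>)"
proof -
  let ?d = "\<zeta>' - \<zeta>"
  have "A \<zeta>' \<bullet> z = A \<zeta> \<bullet> z - A z \<bullet> ?d"
    using skew_commute[of \<zeta>' z] skew_commute[of \<zeta> z] by (simp add: inner_diff_right)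
  moreover have "T e \<zeta> + A (z - \<zeta>) = G \<zeta> + A z + e *\<^sub>R \<zeta>"
    by (simp add: T_def A_diff)
  moreover have "e * (\<zeta> \<bullet> ?d) \<le> e / 2 * ((norm \<zeta>')\<^sup>2 - (norm \<zeta>)\<^sup>2)"
  proof -
    have "(norm \<zeta>')\<^sup>2 - (norm \<zeta>)\<^sup>2 = 2 * (\<zeta> \<bullet> ?d) + ?d \<bullet> ?d"
      by (simp add: power2_norm_eq_inner inner_diff_left inner_diff_right inner_commute)
    then show ?thesis
      using assms by (simp add: field_simps)
  qed
  ultimately show ?thesis
    using gradient_inequality[of \<zeta> \<zeta>'] unfolding gap_def
    by (simp add: inner_add_left algebra_simps)
qed

end

section \<open>Calculus on the half-line\<close>

text \<open>A continuous function grows at most like the integral of \<open>g\<close> if at every point it is touched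
  from above, to the right of the point, by a function whose right derivative there is at most \<open>g\<close>. No
  differentiability of \<open>E\<close> is needed, not even almost everywhere.\<close>

lemma right_majorant_le_integral:
  fixes E g :: "real \<Rightarrow> real"
  assumes "a \<le> b" and E: "continuous_on {a..b} E" and g: "continuous_on {a..b} g"
    and maj: "\<And>t. \<lbrakk>a \<le> t; t < b\<rbrakk> \<Longrightarrow> \<exists>V D. (\<forall>s\<in>{t..b}. E s \<le> V s) \<and> V t = E t \<and>
                (V has_real_derivative D) (at t within {t..b}) \<and> D \<le> g t"
  shows "E b \<le> E a + integral {a..b} g"
proof -
  \<comment> \<open>With the slack \<open>d\<close>, the comparison function grows strictly faster than the majorants, so the
    set of points up to which the bound holds can be continued to the right.\<close>
  have bound: "E b \<le> E a + integral {a..b} g + d * (b - a)" if "d > 0" for d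
  proof -
    define W where "W t = E a + integral {a..t} g + d * (t - a)" for t
    have W_deriv: "(W has_real_derivative g t + d) (at t within {a..b})" if "t \<in> {a..b}" for t
      unfolding W_def[abs_def]
      by (rule derivative_eq_intros integral_has_real_derivative[OF g that] refl | simp)+
    have W: "continuous_on {a..b} W"
      using W_deriv by (meson DERIV_continuous_on)
    define S where "S = {t \<in> {a..b}. \<forall>s\<in>{a..t}. E s \<le> W s}"
    have aS: "a \<in> S"
      using \<open>a \<le> b\<close> by (auto simp: S_def W_def)
    have bdd: "bdd_above S"
      by (rule bdd_aboveI[of _ b]) (auto simp: S_def)
    define c where "c = Sup S"
    have c: "a \<le> c" "c \<le> b"
      unfolding c_def using aS by (intro cSup_upper bdd cSup_least; force simp: S_def)+
    have below: "E s \<le> W s" if "a \<le> s" "s < c" for s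
    proof -
      have "\<exists>t\<in>S. s < t"
        by (rule less_cSupD) (use aS that in \<open>auto simp: c_def\<close>)
      then obtain t where "t \<in> S" "s < t"
        by blast
      then show ?thesis
        using that by (auto simp: S_def)
    qed
    have at_c: "E c \<le> W c"
    proof (cases "a = c")
      case True
      then show ?thesis
        by (simp add: W_def)
    next
      case False
      have "continuous_on {a..c} E" "continuous_on {a..c} W"
        using E W c by (auto intro: continuous_on_subset)
      then have "(E \<longlongrightarrow> E c) (at c within {a..c})" "(W \<longlongrightarrow> W c) (at c within {a..c})"
        using c by (auto simp: continuous_on_def)
      moreover have "eventually (\<lambda>s. E s \<le> W s) (at c within {a..c})"
        using below by (auto simp: eventually_at_filter intro!: always_eventually)
      moreover have "at c within {a..c} \<noteq> bot"
        using False c by (simp add: at_within_Icc_at_left)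
      ultimately show ?thesis
        by (intro tendsto_le)
    qed
    have "c = b"
    proof (rule ccontr)
      assume "c \<noteq> b"
      then have "c < b"
        using c by simp
      then obtain V D where V: "\<forall>s\<in>{c..b}. E s \<le> V s" "V c = E c"
        "(V has_real_derivative D) (at c within {c..b})" "D \<le> g c"
        using maj c by blast
      have "((\<lambda>s. V s - W s) has_real_derivative D - (g c + d)) (at c within {c..b})"
        using c by (intro DERIV_diff V DERIV_subset[OF W_deriv]) auto
      from has_real_derivative_neg_dec_right[OF this] obtain h where h: "h > 0"
        "\<And>k. \<lbrakk>0 < k; c + k \<in> {c..b}; k < h\<rbrakk> \<Longrightarrow> V c - W c > V (c + k) - W (c + k)"
        using V(4) \<open>d > 0\<close> by auto
      define m where "m = min (h / 2) (b - c)"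
      have m: "0 < m" "m < h" "c + m \<le> b"
        using h \<open>c < b\<close> by (auto simp: m_def)
      have "E s \<le> W s" if s: "s \<in> {a..c + m}" for s
      proof (cases "s \<le> c")
        case True
        then show ?thesis
          using below[of s] at_c s by (cases "s = c") auto
      next
        case False
        then have "V c - W c > V s - W s" "E s \<le> V s"
          using h(2)[of "s - c"] V(1) s m c by auto
        then show ?thesis
          using V(2) at_c by simp
      qed
      then have "c + m \<in> S"
        using m c by (auto simp: S_def)
      then have "c + m \<le> c"
        unfolding c_def by (intro cSup_upper bdd)
      then show False
        using m by simp
    qed
    then show ?thesis
      using at_c by (simp add: W_def)
  qed
  show ?thesis
  proof (rule field_le_epsilon)
    fix e :: real assume "e > 0"
    have "e / (b - a + 1) * (b - a) \<le> e"
      using \<open>e > 0\<close> \<open>a \<le> b\<close> by (simp add: field_simps)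
    moreover have "e / (b - a + 1) > 0"
      using \<open>e > 0\<close> \<open>a \<le> b\<close> by simp
    ultimately show "E b \<le> E a + integral {a..b} g + e"
      using bound by (meson add_left_mono order_trans)
  qed
qed

lemma has_real_derivative_inner:
  assumes "(u has_vector_derivative u') (at t within S)" "(v has_vector_derivative v') (at t within S)"
  shows "((\<lambda>s. u s \<bullet> v s) has_real_derivative u t \<bullet> v' + u' \<bullet> v t) (at t within S)"
  using has_derivative_inner[OF assms[unfolded has_vector_derivative_def]]
  unfolding has_field_derivative_def
  by (rule has_derivative_eq_rhs) (simp add: fun_eq_iff algebra_simps)

lemma GDERIV_compose_has_real_derivative:
  assumes "GDERIV \<phi> (z t) :> g" "(z has_vector_derivative z') (at t within S)"
  shows "((\<lambda>s. \<phi> (z s)) has_real_derivative g \<bullet> z') (at t within S)"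
proof -
  have "(\<phi> has_derivative (\<lambda>h. h \<bullet> g)) (at (z t) within z ` S)"
    using assms(1) by (auto simp: gderiv_def inner_commute intro: has_derivative_at_withinI)
  from diff_chain_within[OF assms(2)[unfolded has_vector_derivative_def] this]
  have "((\<lambda>s. \<phi> (z s)) has_derivative (\<lambda>h. (h *\<^sub>R z') \<bullet> g)) (at t within S)"
    by (simp only: o_def)
  moreover have "(\<lambda>h. (h *\<^sub>R z') \<bullet> g) = (*) (g \<bullet> z')"
    by (simp add: fun_eq_iff inner_commute)
  ultimately show ?thesis
    by (simp only: has_field_derivative_def)
qed

lemma quadratic_le:
  fixes l a c :: real
  assumes "l > 0"
  shows "c * a - l / 2 * a\<^sup>2 \<le> c\<^sup>2 / (2 * l)"
proof -
  have "c\<^sup>2 / (2 * l) - (c * a - l / 2 * a\<^sup>2) = (c - l * a)\<^sup>2 / (2 * l)"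
    using assms by (simp add: field_simps power2_eq_square)
  also have "\<dots> \<ge> 0"
    using assms by simp
  finally show ?thesis
    by simp
qed

lemma has_real_derivative_mult_zero:
  assumes "continuous (at t within S) N" "(\<rho> has_real_derivative D) (at t within S)" "\<rho> t = 0"
  shows "((\<lambda>s. N s * \<rho> s) has_real_derivative N t * D) (at t within S)"
proof -
  have "((\<lambda>s. N s * ((\<rho> s - \<rho> t) / (s - t))) \<longlongrightarrow> N t * D) (at t within S)"
    using assms by (intro tendsto_mult) (auto simp: continuous_within has_field_derivative_iff)
  then show ?thesis
    using assms(3) by (simp add: has_field_derivative_iff)
qed

lemma has_vector_derivative_tendsto_quotient:
  assumes "(f has_vector_derivative d) (at t within S)"
  shows "((\<lambda>s. (1 / (s - t)) *\<^sub>R (f s - f t)) \<longlongrightarrow> d) (at t within S)"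
proof -
  have "((\<lambda>s. norm ((f s - f t) - (s - t) *\<^sub>R d) / norm (s - t)) \<longlongrightarrow> 0) (at t within S)"
    using assms by (simp add: has_vector_derivative_def has_derivative_iff_norm)
  moreover have "eventually (\<lambda>s. norm ((f s - f t) - (s - t) *\<^sub>R d) / norm (s - t)
      = norm ((1 / (s - t)) *\<^sub>R (f s - f t) - d)) (at t within S)"
  proof -
    have "norm ((f s - f t) - (s - t) *\<^sub>R d) / norm (s - t) = norm ((1 / (s - t)) *\<^sub>R (f s - f t) - d)"
      if "s \<noteq> t" for s
    proof -
      have "(1 / (s - t)) *\<^sub>R (f s - f t) - d = (1 / (s - t)) *\<^sub>R ((f s - f t) - (s - t) *\<^sub>R d)"
        using that by (simp add: scaleR_diff_right)
      then show ?thesis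
        by simp
    qed
    then show ?thesis
      by (auto simp: eventually_at_filter intro!: always_eventually)
  qed
  ultimately have "((\<lambda>s. norm ((1 / (s - t)) *\<^sub>R (f s - f t) - d)) \<longlongrightarrow> 0) (at t within S)"
    by (rule Lim_transform_eventually)
  then show ?thesis
    by (simp add: tendsto_norm_zero_iff LIM_zero_iff)
qed

section \<open>Coefficients and the path of regularized saddle points\<close>

text \<open>The coefficients of the dynamics, together with a reference zero \<open>p\<close> of the unregularized
  operator; only its norm enters the estimates.\<close>

locale tikhonov_coefficients = regularized_saddle +
  fixes t0 \<theta> :: real and \<alpha> \<alpha>' \<beta> \<beta>' \<epsilon> \<epsilon>' :: "real \<Rightarrow> real" and p :: 'a
  assumes t0_ge: "t0 \<ge> 1" and \<theta>_pos: "\<theta> > 0"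
    and \<alpha>_pos: "t \<ge> t0 \<Longrightarrow> \<alpha> t > 0" and \<beta>_pos: "t \<ge> t0 \<Longrightarrow> \<beta> t > 0"
    and \<epsilon>_pos: "t \<ge> t0 \<Longrightarrow> \<epsilon> t > 0"
    and \<alpha>_deriv: "t \<ge> t0 \<Longrightarrow> (\<alpha> has_real_derivative \<alpha>' t) (at t within {t0..})"
    and \<beta>_deriv: "t \<ge> t0 \<Longrightarrow> (\<beta> has_real_derivative \<beta>' t) (at t within {t0..})"
    and \<epsilon>_deriv: "t \<ge> t0 \<Longrightarrow> (\<epsilon> has_real_derivative \<epsilon>' t) (at t within {t0..})"
    and \<alpha>'_cont: "continuous_on {t0..} \<alpha>'" and \<epsilon>'_cont: "continuous_on {t0..} \<epsilon>'"
    and \<epsilon>_antimono: "antimono_on {t0..} \<epsilon>"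
    and damping: "t \<ge> t0 \<Longrightarrow> 1 + \<theta> - \<theta> * t * \<alpha> t < 0"
    and scaling: "t \<ge> t0 \<Longrightarrow> (2 * \<theta> - 1) * \<beta> t + \<theta> * t * \<beta>' t \<le> 0"
    and regularization: "t \<ge> t0 \<Longrightarrow> \<alpha> t + t * \<alpha>' t < t * \<beta> t * \<epsilon> t"
    and zero: "T 0 p = 0"
begin

text \<open>The functions \<open>l\<close> and \<open>\<Gamma>\<close> turn out to be, up to factors, the rates at which the energy dissipates the squared
  distance to the regularized saddle point and the squared velocity, \<open>H\<close> measures the size of the
  coefficients, and \<open>\<Psi>\<close> controls the effect of the decay of \<open>\<epsilon>\<close>.\<close>

definition l :: "real \<Rightarrow> real" where
  "l t = 1 / (\<theta> * t) * (\<beta> t * \<epsilon> t - \<alpha>' t - \<alpha> t / t)"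

definition \<Gamma> :: "real \<Rightarrow> real" where
  "\<Gamma> t = \<alpha> t - (1 + \<theta>) / (\<theta> * t)"

definition H :: "real \<Rightarrow> real" where
  "H t = \<beta> t + \<beta> t * \<epsilon> t + \<alpha> t - 1 / (\<theta> * t)"

definition \<Psi> :: "real \<Rightarrow> real" where
  "\<Psi> t = (\<bar>\<epsilon>' t\<bar> / \<epsilon> t)\<^sup>2 * ((H t)\<^sup>2 / l t + 1 / (t\<^sup>2 * \<Gamma> t))"

text \<open>The saddle point of the problem regularized with parameter \<open>\<epsilon> t\<close>; meaningful for
  \<open>t \<ge> t0\<close>, where \<open>\<epsilon> t > 0\<close>.\<close>

definition zt :: "real \<Rightarrow> 'a" where
  "zt t = zsol (\<epsilon> t)"

text \<open>A constant for which \<open>drift_const * H t\<close> dominates the coefficients of the perturbation caused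
  by the motion of \<^const>\<open>zt\<close>; see \<open>drift_le\<close>.\<close>

definition drift_const :: real where
  "drift_const = 1 + onorm A + (1 + \<theta>) / \<theta>\<^sup>2"

lemma t_pos: "t \<ge> t0 \<Longrightarrow> t > 0"
  using t0_ge by simp

lemma l_pos: "t \<ge> t0 \<Longrightarrow> l t > 0"
  using regularization[of t] t_pos[of t] \<theta>_pos by (simp add: l_def field_simps)

lemma \<Gamma>_pos: "t \<ge> t0 \<Longrightarrow> \<Gamma> t > 0"
  using damping[of t] t_pos[of t] \<theta>_pos by (simp add: \<Gamma>_def field_simps)

lemma \<epsilon>'_nonpos:
  assumes "t \<ge> t0" shows "\<epsilon>' t \<le> 0"
proof (rule ccontr)
  assume "\<not> ?thesis"
  then obtain d where "d > 0" "\<And>h. \<lbrakk>0 < h; t + h \<in> {t0..}; h < d\<rbrakk> \<Longrightarrow> \<epsilon> t < \<epsilon> (t + h)"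
    using has_real_derivative_pos_inc_right[OF \<epsilon>_deriv[OF assms]] by (auto simp: not_le)
  from this(2)[of "d / 2"] have "\<epsilon> t < \<epsilon> (t + d / 2)"
    using assms \<open>d > 0\<close> by auto
  moreover have "\<epsilon> (t + d / 2) \<le> \<epsilon> t"
    using \<epsilon>_antimono assms \<open>d > 0\<close> by (auto simp: monotone_on_def)
  ultimately show False
    by simp
qed

lemma drift_coefficient_nonneg:
  assumes t: "t \<ge> t0" shows "0 \<le> (\<alpha> t - 1 / t) / (\<theta> * t)"
proof -
  have "\<theta> * 1 < \<theta> * (t * \<alpha> t)"
    using damping[OF t] by (simp add: algebra_simps)
  then have "1 < t * \<alpha> t"
    using \<theta>_pos by simp
  then show ?thesis
    using t_pos[OF t] \<theta>_pos by (simp add: field_simps)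
qed

lemma H_bounds:
  assumes t: "t \<ge> t0"
  shows "\<beta> t \<le> H t" "\<beta> t * \<epsilon> t \<le> H t" "(\<alpha> t - 1 / t) / (\<theta> * t) \<le> (1 + \<theta>) / \<theta>\<^sup>2 * H t"
proof -
  note pos = t_pos[OF t] \<theta>_pos \<beta>_pos[OF t] \<epsilon>_pos[OF t] \<alpha>_pos[OF t]
  have "1 / (\<theta> * t) \<le> \<alpha> t / (1 + \<theta>)"
    using damping[OF t] pos by (simp add: field_simps)
  moreover have "\<alpha> t - \<alpha> t / (1 + \<theta>) = \<theta> / (1 + \<theta>) * \<alpha> t"
    using pos by (simp add: field_simps)
  ultimately have *: "\<theta> / (1 + \<theta>) * \<alpha> t \<le> \<alpha> t - 1 / (\<theta> * t)"
    by linarith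
  moreover have "0 < \<theta> / (1 + \<theta>) * \<alpha> t"
    using pos by simp
  moreover have "0 < \<beta> t * \<epsilon> t"
    using pos by simp
  ultimately show "\<beta> t \<le> H t" "\<beta> t * \<epsilon> t \<le> H t"
    using pos unfolding H_def by linarith+
  have "(\<alpha> t - 1 / t) / (\<theta> * t) \<le> \<alpha> t / (\<theta> * t)"
    using pos by (intro divide_right_mono) auto
  also have "\<dots> \<le> \<alpha> t / \<theta>"
    using pos t t0_ge by (intro divide_left_mono) auto
  also have "\<dots> = (1 + \<theta>) / \<theta>\<^sup>2 * (\<theta> / (1 + \<theta>) * \<alpha> t)"
  proof -
    have "1 + \<theta> \<noteq> 0" "\<theta> \<noteq> 0"
      using pos by auto
    then show ?thesis
      by (simp add: power2_eq_square)
  qed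
  also have "\<dots> \<le> (1 + \<theta>) / \<theta>\<^sup>2 * H t"
  proof (rule mult_left_mono)
    show "\<theta> / (1 + \<theta>) * \<alpha> t \<le> H t"
      using * pos(3) \<open>0 < \<beta> t * \<epsilon> t\<close> unfolding H_def by linarith
  qed (use pos in simp)
  finally show "(\<alpha> t - 1 / t) / (\<theta> * t) \<le> (1 + \<theta>) / \<theta>\<^sup>2 * H t" .
qed

lemma drift_le:
  assumes t: "t \<ge> t0"
  shows "\<beta> t * \<epsilon> t + \<beta> t * onorm A + (\<alpha> t - 1 / t) / (\<theta> * t) \<le> drift_const * H t"
proof -
  have "\<beta> t * onorm A \<le> H t * onorm A"
    using H_bounds(1)[OF t] onorm_pos_le[OF lin] by (rule mult_right_mono)
  then show ?thesis
    using H_bounds[OF t] by (simp add: drift_const_def algebra_simps)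
qed

lemma continuous_coefficients:
  "continuous_on {t0..} \<alpha>" "continuous_on {t0..} \<beta>" "continuous_on {t0..} \<epsilon>"
  using \<alpha>_deriv \<beta>_deriv \<epsilon>_deriv by (auto intro!: DERIV_continuous_on)

lemma continuous_l: "continuous_on {t0..} l"
  unfolding l_def using t_pos \<theta>_pos
  by (intro continuous_intros continuous_coefficients \<alpha>'_cont) force+

lemma continuous_\<Gamma>: "continuous_on {t0..} \<Gamma>"
  unfolding \<Gamma>_def using t_pos \<theta>_pos by (intro continuous_intros continuous_coefficients) force+

lemma continuous_\<Psi>: "continuous_on {t0..} \<Psi>"
proof -
  have "\<forall>t\<in>{t0..}. \<theta> * t \<noteq> 0" "\<forall>t\<in>{t0..}. \<epsilon> t \<noteq> 0" "\<forall>t\<in>{t0..}. l t \<noteq> 0" "\<forall>t\<in>{t0..}. t\<^sup>2 * \<Gamma> t \<noteq> 0"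
    using t_pos \<theta>_pos \<epsilon>_pos l_pos \<Gamma>_pos by force+
  then show ?thesis
    unfolding \<Psi>_def H_def
    by (intro continuous_intros continuous_coefficients \<epsilon>'_cont continuous_l continuous_\<Gamma>)
qed

lemma T_zt: "t \<ge> t0 \<Longrightarrow> T (\<epsilon> t) (zt t) = 0"
  unfolding zt_def by (intro T_zsol \<epsilon>_pos)

lemma norm_zt_le: "t \<ge> t0 \<Longrightarrow> norm (zt t) \<le> norm p"
  unfolding zt_def by (intro norm_zsol_le \<epsilon>_pos zero)

text \<open>The key estimate on the motion of the regularized saddle points. Dividing by \<open>s - t\<close> shows
  that their speed is at most \<open>|\<epsilon>' t| / \<epsilon> t * norm (zt t)\<close> wherever it exists.\<close>

lemma zt_diff_le:
  "\<lbrakk>s \<ge> t0; t \<ge> t0\<rbrakk> \<Longrightarrow> norm (zt s - zt t) \<le> \<bar>\<epsilon> t - \<epsilon> s\<bar> / \<epsilon> s * norm (zt t)"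
  unfolding zt_def by (intro zsol_diff_le \<epsilon>_pos)

lemma continuous_zt: "continuous_on {t0..} zt"
  unfolding continuous_on_def
proof
  fix t assume t: "t \<in> {t0..}"
  have \<epsilon>: "(\<epsilon> \<longlongrightarrow> \<epsilon> t) (at t within {t0..})"
    using continuous_coefficients(3) t by (auto simp: continuous_on_def)
  have "((\<lambda>s. \<bar>\<epsilon> t - \<epsilon> s\<bar> / \<epsilon> s * norm (zt t)) \<longlongrightarrow> \<bar>\<epsilon> t - \<epsilon> t\<bar> / \<epsilon> t * norm (zt t)) (at t within {t0..})"
    using \<epsilon>_pos[of t] t by (intro tendsto_intros \<epsilon>) auto
  then have lim: "((\<lambda>s. \<bar>\<epsilon> t - \<epsilon> s\<bar> / \<epsilon> s * norm (zt t)) \<longlongrightarrow> 0) (at t within {t0..})"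
    by simp
  have "((\<lambda>s. zt s - zt t) \<longlongrightarrow> 0) (at t within {t0..})"
    by (rule Lim_null_comparison[OF _ lim])
      (use t zt_diff_le in \<open>auto simp: eventually_at_filter intro!: always_eventually\<close>)
  then show "(zt \<longlongrightarrow> zt t) (at t within {t0..})"
    by (simp add: LIM_zero_iff)
qed

end

section \<open>The energy along a trajectory\<close>

context tikhonov_coefficients
begin

text \<open>The Lyapunov function at time \<open>s\<close>, for a trajectory \<open>z\<close> with velocity \<open>z'\<close>, measured from the
  point \<open>\<zeta>\<close>. The anchor \<open>\<zeta>\<close> is kept separate from \<open>s\<close>: the map \<^const>\<open>zt\<close> is only locally Lipschitz, so
  the derivative in \<open>s\<close> is taken with \<open>\<zeta>\<close> fixed.\<close>

definition energy :: "(real \<Rightarrow> 'a) \<Rightarrow> (real \<Rightarrow> 'a) \<Rightarrow> real \<Rightarrow> 'a \<Rightarrow> real" where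
  "energy z z' s \<zeta> = \<theta>\<^sup>2 * s\<^sup>2 * \<beta> s * gap (\<epsilon> s) \<zeta> (z s)
     + (norm (z s - \<zeta> + (\<theta> * s) *\<^sub>R z' s))\<^sup>2 / 2
     + (\<theta> * s * \<alpha> s - 1 - \<theta>) / 2 * (norm (z s - \<zeta>))\<^sup>2"

lemma energy_has_derivative:
  assumes t: "t \<ge> t0"
    and z: "(z has_vector_derivative z' t) (at t within {t0..})"
    and z': "(z' has_vector_derivative z'') (at t within {t0..})"
  shows "((\<lambda>s. energy z z' s \<zeta>) has_real_derivative
     (2 * \<theta>\<^sup>2 * t * \<beta> t + \<theta>\<^sup>2 * t\<^sup>2 * \<beta>' t) * gap (\<epsilon> t) \<zeta> (z t)
     + \<theta>\<^sup>2 * t\<^sup>2 * \<beta> t * ((G (z t) + A \<zeta> + \<epsilon> t *\<^sub>R z t) \<bullet> z' t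
         + \<epsilon>' t / 2 * ((norm (z t))\<^sup>2 - (norm \<zeta>)\<^sup>2))
     + (z t - \<zeta> + (\<theta> * t) *\<^sub>R z' t) \<bullet> ((1 + \<theta>) *\<^sub>R z' t + (\<theta> * t) *\<^sub>R z'')
     + \<theta> * (\<alpha> t + t * \<alpha>' t) / 2 * (norm (z t - \<zeta>))\<^sup>2
     + (\<theta> * t * \<alpha> t - 1 - \<theta>) * ((z t - \<zeta>) \<bullet> z' t)) (at t within {t0..})"
proof -
  let ?F = "at t within {t0..}"
  have d\<phi>: "((\<lambda>s. \<phi> (z s)) has_real_derivative G (z t) \<bullet> z' t) ?F"
    by (rule GDERIV_compose_has_real_derivative[OF grad z])
  have dA: "((\<lambda>s. A \<zeta> \<bullet> z s) has_real_derivative A \<zeta> \<bullet> z' t) ?F"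
    using has_real_derivative_inner[OF has_vector_derivative_const z] by simp
  have dzz: "((\<lambda>s. (norm (z s))\<^sup>2) has_real_derivative 2 * (z t \<bullet> z' t)) ?F"
    using has_real_derivative_inner[OF z z] by (simp add: power2_norm_eq_inner inner_commute)
  have p: "((\<lambda>s. z s - \<zeta>) has_vector_derivative z' t) ?F"
    using has_vector_derivative_diff[OF z has_vector_derivative_const] by simp
  have dpp: "((\<lambda>s. (norm (z s - \<zeta>))\<^sup>2) has_real_derivative 2 * ((z t - \<zeta>) \<bullet> z' t)) ?F"
    using has_real_derivative_inner[OF p p] by (simp add: power2_norm_eq_inner inner_commute)
  have "((\<lambda>s. (\<theta> * s) *\<^sub>R z' s) has_vector_derivative (\<theta> * t) *\<^sub>R z'' + \<theta> *\<^sub>R z' t) ?F"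
    by (rule has_vector_derivative_scaleR[OF _ z']) (auto intro!: derivative_eq_intros)
  from has_vector_derivative_add[OF p this]
  have v: "((\<lambda>s. z s - \<zeta> + (\<theta> * s) *\<^sub>R z' s) has_vector_derivative
      ((1 + \<theta>) *\<^sub>R z' t + (\<theta> * t) *\<^sub>R z'')) ?F"
    by (simp add: scaleR_add_left add_ac)
  have dvv: "((\<lambda>s. (norm (z s - \<zeta> + (\<theta> * s) *\<^sub>R z' s))\<^sup>2) has_real_derivative
     2 * ((z t - \<zeta> + (\<theta> * t) *\<^sub>R z' t) \<bullet> ((1 + \<theta>) *\<^sub>R z' t + (\<theta> * t) *\<^sub>R z''))) ?F"
    using has_real_derivative_inner[OF v v] by (simp add: power2_norm_eq_inner inner_commute)
  have dgap: "((\<lambda>s. gap (\<epsilon> s) \<zeta> (z s)) has_real_derivative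
     (G (z t) + A \<zeta> + \<epsilon> t *\<^sub>R z t) \<bullet> z' t + \<epsilon>' t / 2 * ((norm (z t))\<^sup>2 - (norm \<zeta>)\<^sup>2)) ?F"
  proof -
    have "((\<lambda>s. \<epsilon> s / 2 * ((norm (z s))\<^sup>2 - (norm \<zeta>)\<^sup>2)) has_real_derivative
       \<epsilon>' t / 2 * ((norm (z t))\<^sup>2 - (norm \<zeta>)\<^sup>2) + (2 * (z t \<bullet> z' t) - 0) * (\<epsilon> t / 2)) ?F"
      by (intro DERIV_mult DERIV_diff DERIV_const dzz DERIV_cdivide \<epsilon>_deriv[OF t])
    from DERIV_add[OF DERIV_add[OF DERIV_diff[OF d\<phi> DERIV_const] dA] this]
    show ?thesis
      unfolding gap_def by (rule DERIV_cong) (simp add: inner_add_left)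
  qed
  show ?thesis
  proof -
    have d1: "((\<lambda>s. \<theta>\<^sup>2 * s\<^sup>2 * \<beta> s) has_real_derivative
        2 * \<theta>\<^sup>2 * t * \<beta> t + \<theta>\<^sup>2 * t\<^sup>2 * \<beta>' t) ?F"
      by (rule derivative_eq_intros \<beta>_deriv[OF t] refl)+ (simp add: algebra_simps)
    have "((\<lambda>s. \<theta> * s * \<alpha> s - 1 - \<theta>) has_real_derivative \<theta> * (\<alpha> t + t * \<alpha>' t)) ?F"
      by (rule derivative_eq_intros \<alpha>_deriv[OF t] refl)+ (simp add: algebra_simps)
    from DERIV_mult[OF DERIV_cdivide[OF this, of 2] dpp]
    have d3: "((\<lambda>s. (\<theta> * s * \<alpha> s - 1 - \<theta>) / 2 * (norm (z s - \<zeta>))\<^sup>2) has_real_derivative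
        \<theta> * (\<alpha> t + t * \<alpha>' t) / 2 * (norm (z t - \<zeta>))\<^sup>2
        + (\<theta> * t * \<alpha> t - 1 - \<theta>) * ((z t - \<zeta>) \<bullet> z' t)) ?F"
      by (rule DERIV_cong) simp
    have d2: "((\<lambda>s. (norm (z s - \<zeta> + (\<theta> * s) *\<^sub>R z' s))\<^sup>2 / 2) has_real_derivative
        (z t - \<zeta> + (\<theta> * t) *\<^sub>R z' t) \<bullet> ((1 + \<theta>) *\<^sub>R z' t + (\<theta> * t) *\<^sub>R z'')) ?F"
      by (rule DERIV_cong[OF DERIV_cdivide[OF dvv]]) simp
    from DERIV_add[OF DERIV_add[OF DERIV_mult[OF d1 dgap] d2] d3]
    show ?thesis
      unfolding energy_def by (rule DERIV_cong) (simp add: mult.commute)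
  qed
qed

text \<open>With \<open>x\<close>, \<open>w\<close> and \<open>z''\<close> for position, velocity and acceleration, the left-hand side is the
  derivative found in \<open>energy_has_derivative\<close>. The extrapolated argument \<open>x + \<theta> t w\<close> of \<open>A\<close> equals
  \<open>\<zeta> + v\<close> with \<open>v = x - \<zeta> + \<theta> t w\<close>, and the term \<open>A v \<bullet> v\<close> vanishes by skewness.\<close>

lemma energy_derivative_le:
  assumes t: "t \<ge> t0"
    and ode: "z'' + \<alpha> t *\<^sub>R w + \<beta> t *\<^sub>R (G x + A (x + (\<theta> * t) *\<^sub>R w) + \<epsilon> t *\<^sub>R x) = 0"
  shows "(2 * \<theta>\<^sup>2 * t * \<beta> t + \<theta>\<^sup>2 * t\<^sup>2 * \<beta>' t) * gap (\<epsilon> t) \<zeta> x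
     + \<theta>\<^sup>2 * t\<^sup>2 * \<beta> t * ((G x + A \<zeta> + \<epsilon> t *\<^sub>R x) \<bullet> w
         + \<epsilon>' t / 2 * ((norm x)\<^sup>2 - (norm \<zeta>)\<^sup>2))
     + (x - \<zeta> + (\<theta> * t) *\<^sub>R w) \<bullet> ((1 + \<theta>) *\<^sub>R w + (\<theta> * t) *\<^sub>R z'')
     + \<theta> * (\<alpha> t + t * \<alpha>' t) / 2 * (norm (x - \<zeta>))\<^sup>2
     + (\<theta> * t * \<alpha> t - 1 - \<theta>) * ((x - \<zeta>) \<bullet> w)
   \<le> \<theta> * t * ((2 * \<theta> - 1) * \<beta> t + \<theta> * t * \<beta>' t) * gap (\<epsilon> t) \<zeta> x
     + \<theta>\<^sup>2 * t\<^sup>2 * \<beta> t * (\<epsilon>' t / 2 * ((norm x)\<^sup>2 - (norm \<zeta>)\<^sup>2))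
     - \<theta>\<^sup>2 * t\<^sup>2 * (\<Gamma> t * (norm w)\<^sup>2 + l t / 2 * (norm (x - \<zeta>))\<^sup>2)"
proof -
  let ?p = "x - \<zeta>"
  define X where "X = G x + A \<zeta> + \<epsilon> t *\<^sub>R x"
  define v where "v = ?p + (\<theta> * t) *\<^sub>R w"
  note pos = t_pos[OF t] \<theta>_pos \<beta>_pos[OF t] \<epsilon>_pos[OF t] \<alpha>_pos[OF t]
  have "x + (\<theta> * t) *\<^sub>R w = \<zeta> + v"
    by (simp add: v_def)
  then have z'': "z'' = - (\<alpha> t *\<^sub>R w) - \<beta> t *\<^sub>R (X + A v)"
    using ode by (simp add: A_add X_def algebra_simps eq_neg_iff_add_eq_0)
  have vw: "v \<bullet> w = ?p \<bullet> w + \<theta> * t * (norm w)\<^sup>2" and vX: "v \<bullet> X = X \<bullet> ?p + \<theta> * t * (X \<bullet> w)"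
    by (simp_all add: v_def inner_add_left power2_norm_eq_inner inner_commute[of X])
  have vz: "v \<bullet> ((1 + \<theta>) *\<^sub>R w + (\<theta> * t) *\<^sub>R z'')
      = (1 + \<theta> - \<theta> * t * \<alpha> t) * (?p \<bullet> w + \<theta> * t * (norm w)\<^sup>2)
        - \<theta> * t * \<beta> t * (X \<bullet> ?p + \<theta> * t * (X \<bullet> w))"
    unfolding z'' vw[symmetric] vX[symmetric] using skew[of v]
    by (simp add: inner_add_right inner_diff_right inner_commute[of v "A v"] algebra_simps)
  have Xp: "gap (\<epsilon> t) \<zeta> x + \<epsilon> t / 2 * (norm ?p)\<^sup>2 \<le> X \<bullet> ?p"
  proof -
    have "A \<zeta> \<bullet> ?p = A \<zeta> \<bullet> x"
      using skew[of \<zeta>] by (simp add: inner_diff_right)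
    moreover have "\<epsilon> t * (x \<bullet> ?p) = \<epsilon> t / 2 * ((norm x)\<^sup>2 - (norm \<zeta>)\<^sup>2) + \<epsilon> t / 2 * (norm ?p)\<^sup>2"
      by (simp add: power2_norm_eq_inner inner_diff_left inner_diff_right inner_commute field_simps)
    moreover have "\<phi> x - \<phi> \<zeta> \<le> G x \<bullet> ?p"
      using gradient_inequality[of x \<zeta>] by (simp add: inner_diff_right)
    ultimately show ?thesis
      unfolding gap_def X_def inner_add_left inner_scaleR_left by linarith
  qed
  have "\<theta> * t * \<beta> t * (gap (\<epsilon> t) \<zeta> x + \<epsilon> t / 2 * (norm ?p)\<^sup>2) \<le> \<theta> * t * \<beta> t * (X \<bullet> ?p)"
    using pos by (intro mult_left_mono Xp) auto
  moreover have "\<theta>\<^sup>2 * t\<^sup>2 * \<Gamma> t = \<theta> * t * (\<theta> * t * \<alpha> t - 1 - \<theta>)"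
    using pos by (simp add: \<Gamma>_def field_simps power2_eq_square)
  then have G1: "\<theta>\<^sup>2 * t\<^sup>2 * (\<Gamma> t * (norm w)\<^sup>2) = \<theta> * t * (\<theta> * t * \<alpha> t - 1 - \<theta>) * (norm w)\<^sup>2"
    by (metis mult.assoc)
  moreover have "\<theta>\<^sup>2 * t\<^sup>2 * (l t / 2) = \<theta> * (t * \<beta> t * \<epsilon> t - t * \<alpha>' t - \<alpha> t) / 2"
    using pos by (simp add: l_def field_simps power2_eq_square)
  then have G2: "\<theta>\<^sup>2 * t\<^sup>2 * (l t / 2 * (norm ?p)\<^sup>2) =
      \<theta> * (t * \<beta> t * \<epsilon> t - t * \<alpha>' t - \<alpha> t) / 2 * (norm ?p)\<^sup>2"
    by (metis mult.assoc)
  moreover define n where "n = (norm ?p)\<^sup>2"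
  moreover define S where "S = X \<bullet> ?p"
  ultimately show ?thesis
    unfolding v_def[symmetric] X_def[symmetric] vz distrib_left[of "\<theta>\<^sup>2 * t\<^sup>2" "\<Gamma> t * _"] G1 G2
      n_def[symmetric] S_def[symmetric]
    by (simp add: field_simps power2_eq_square)
qed

end

context tikhonov_coefficients
begin

text \<open>The cost of moving the anchor from the regularized saddle point \<open>\<zeta>\<close> to a point \<open>\<xi>\<close> at distance
  at most \<open>r\<close>: it is of first order in \<open>r\<close>.\<close>

lemma energy_change_le:
  assumes s: "s \<ge> t0" and r: "norm (\<xi> - \<zeta>) \<le> r" and e: "e \<ge> \<epsilon> s" "T e \<zeta> = 0"
  shows "energy z z' s \<xi> \<le> energy z z' s \<zeta> +
    (\<theta>\<^sup>2 * s\<^sup>2 * \<beta> s * ((e - \<epsilon> s) * norm \<zeta> + onorm A * norm (z s - \<zeta>))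
     + (\<theta> * s * \<alpha> s - \<theta>) * norm (z s - \<zeta>) + \<theta> * s * norm (z' s)
     + (\<theta> * s * \<alpha> s - \<theta>) / 2 * r) * r"
proof -
  note pos = t_pos[OF s] \<theta>_pos \<beta>_pos[OF s] \<epsilon>_pos[OF s] \<alpha>_pos[OF s]
  define d where "d = \<xi> - \<zeta>"
  define x where "x = z s - \<zeta>"
  define c where "c = \<theta> * s * \<alpha> s - \<theta>"
  have c: "c \<ge> 0"
    using damping[OF s] by (simp add: c_def)
  have r0: "0 \<le> norm d" "norm d \<le> r" "0 \<le> r"
    using r by (auto simp: d_def intro: order_trans[OF norm_ge_zero])
  have gap_le: "gap (\<epsilon> s) \<xi> (z s) \<le> gap (\<epsilon> s) \<zeta> (z s)
      + ((e - \<epsilon> s) * norm \<zeta> + onorm A * norm x) * r"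
  proof -
    have "T (\<epsilon> s) \<zeta> = (\<epsilon> s - e) *\<^sub>R \<zeta>"
      using T_diff[of "\<epsilon> s" \<zeta> e] e(2) by simp
    then have "norm (T (\<epsilon> s) \<zeta>) = (e - \<epsilon> s) * norm \<zeta>"
      using e(1) by simp
    then have "norm (T (\<epsilon> s) \<zeta> + A x) \<le> (e - \<epsilon> s) * norm \<zeta> + onorm A * norm x"
      using onorm[OF lin, of x] norm_triangle_ineq[of "T (\<epsilon> s) \<zeta>" "A x"] by linarith
    then have "norm (T (\<epsilon> s) \<zeta> + A x) * norm d \<le> ((e - \<epsilon> s) * norm \<zeta> + onorm A * norm x) * r"
      using r0 by (intro mult_mono) (auto intro: order_trans[OF norm_ge_zero])
    moreover have "- ((T (\<epsilon> s) \<zeta> + A x) \<bullet> d) \<le> norm (T (\<epsilon> s) \<zeta> + A x) * norm d"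
      using Cauchy_Schwarz_ineq2[of "T (\<epsilon> s) \<zeta> + A x" d] by linarith
    ultimately show ?thesis
      using gap_change_le[of "\<epsilon> s" \<xi> "z s" \<zeta>] pos by (simp add: d_def x_def)
  qed
  have "\<theta>\<^sup>2 * s\<^sup>2 * \<beta> s * gap (\<epsilon> s) \<xi> (z s) \<le> \<theta>\<^sup>2 * s\<^sup>2 * \<beta> s * (gap (\<epsilon> s) \<zeta> (z s)
      + ((e - \<epsilon> s) * norm \<zeta> + onorm A * norm x) * r)"
    using pos by (intro mult_left_mono gap_le) auto
  moreover have "(norm (x - d + (\<theta> * s) *\<^sub>R z' s))\<^sup>2 / 2 + (c - 1) / 2 * (norm (x - d))\<^sup>2
     \<le> (norm (x + (\<theta> * s) *\<^sub>R z' s))\<^sup>2 / 2 + (c - 1) / 2 * (norm x)\<^sup>2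
       + (c * norm x + \<theta> * s * norm (z' s) + c / 2 * r) * r"
  proof -
    have "(norm (x - d + (\<theta> * s) *\<^sub>R z' s))\<^sup>2 / 2 + (c - 1) / 2 * (norm (x - d))\<^sup>2
      = (norm (x + (\<theta> * s) *\<^sub>R z' s))\<^sup>2 / 2 + (c - 1) / 2 * (norm x)\<^sup>2
       - (c *\<^sub>R x + (\<theta> * s) *\<^sub>R z' s) \<bullet> d + c / 2 * (norm d * norm d)"
      unfolding power2_norm_eq_inner power2_eq_square[symmetric]
      by (simp add: inner_diff_left inner_diff_right inner_add_left inner_add_right inner_commute field_simps)
    moreover have "norm (c *\<^sub>R x + (\<theta> * s) *\<^sub>R z' s) \<le> c * norm x + \<theta> * s * norm (z' s)"
      using norm_triangle_ineq[of "c *\<^sub>R x" "(\<theta> * s) *\<^sub>R z' s"] c pos by simp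
    then have "norm (c *\<^sub>R x + (\<theta> * s) *\<^sub>R z' s) * norm d \<le> (c * norm x + \<theta> * s * norm (z' s)) * r"
      using r0 by (intro mult_mono) (auto intro: order_trans[OF norm_ge_zero])
    moreover have "- ((c *\<^sub>R x + (\<theta> * s) *\<^sub>R z' s) \<bullet> d) \<le> norm (c *\<^sub>R x + (\<theta> * s) *\<^sub>R z' s) * norm d"
      using Cauchy_Schwarz_ineq2[of "c *\<^sub>R x + (\<theta> * s) *\<^sub>R z' s" d] by linarith
    moreover have "c / 2 * (norm d * norm d) \<le> c / 2 * (r * r)"
      using r0 c by (intro mult_left_mono mult_mono) auto
    ultimately show ?thesis
      by (simp add: distrib_right)
  qed
  moreover have xd: "z s - \<xi> = x - d"
    by (simp add: x_def d_def)
  moreover have c1: "\<theta> * s * \<alpha> s - 1 - \<theta> = c - 1"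
    by (simp add: c_def)
  ultimately show ?thesis
    unfolding energy_def c1 xd c_def[symmetric] x_def[symmetric]
    by (simp add: distrib_left distrib_right mult.assoc)
qed

text \<open>One constant that serves both for the growth of the energy and for the bound on the
  residual.\<close>

definition growth_const :: real where
  "growth_const = (\<theta>\<^sup>2 * drift_const\<^sup>2 / 2 + 1 / 4 + 1 / (2 * \<theta>\<^sup>2) + drift_const\<^sup>2) * (norm p)\<^sup>2"

lemma growth_const_bound:
  assumes t: "t \<ge> t0" and abc: "0 \<le> a" "0 \<le> b"
    "a \<le> \<theta>\<^sup>2 * drift_const\<^sup>2 / 2 + drift_const\<^sup>2" "b \<le> 1 / 4 + 1 / (2 * \<theta>\<^sup>2)" and q: "0 \<le> q" "q \<le> \<bar>\<epsilon>' t\<bar> / \<epsilon> t * norm p"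
  shows "t\<^sup>2 * (a * ((H t)\<^sup>2 / l t) + b * (1 / (t\<^sup>2 * \<Gamma> t))) * q\<^sup>2 \<le> growth_const * (t\<^sup>2 * \<Psi> t)"
proof -
  let ?c = "\<theta>\<^sup>2 * drift_const\<^sup>2 / 2 + 1 / 4 + 1 / (2 * \<theta>\<^sup>2) + drift_const\<^sup>2"
  have pos: "0 \<le> (H t)\<^sup>2 / l t" "0 \<le> 1 / (t\<^sup>2 * \<Gamma> t)"
    using l_pos[OF t] \<Gamma>_pos[OF t] by auto
  have nn: "0 \<le> \<theta>\<^sup>2 * drift_const\<^sup>2 / 2" "0 \<le> 1 / (2 * \<theta>\<^sup>2)" "0 \<le> drift_const\<^sup>2"
    by auto
  have "a * ((H t)\<^sup>2 / l t) + b * (1 / (t\<^sup>2 * \<Gamma> t)) \<le> ?c * ((H t)\<^sup>2 / l t) + ?c * (1 / (t\<^sup>2 * \<Gamma> t))"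
    using abc nn by (intro add_mono mult_right_mono pos) linarith+
  also have "\<dots> = ?c * ((H t)\<^sup>2 / l t + 1 / (t\<^sup>2 * \<Gamma> t))"
    by (simp only: distrib_left)
  finally have 1: "a * ((H t)\<^sup>2 / l t) + b * (1 / (t\<^sup>2 * \<Gamma> t)) \<le> ?c * ((H t)\<^sup>2 / l t + 1 / (t\<^sup>2 * \<Gamma> t))" .
  have 2: "q\<^sup>2 \<le> (\<bar>\<epsilon>' t\<bar> / \<epsilon> t * norm p)\<^sup>2"
    using q by (rule power_mono[rotated])
  have "t\<^sup>2 * (a * ((H t)\<^sup>2 / l t) + b * (1 / (t\<^sup>2 * \<Gamma> t))) * q\<^sup>2
     \<le> t\<^sup>2 * (?c * ((H t)\<^sup>2 / l t + 1 / (t\<^sup>2 * \<Gamma> t))) * (\<bar>\<epsilon>' t\<bar> / \<epsilon> t * norm p)\<^sup>2"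
    using 1 2 pos abc nn by (intro mult_mono mult_left_mono) (auto intro!: mult_nonneg_nonneg add_nonneg_nonneg)
  also have "\<dots> = growth_const * (t\<^sup>2 * \<Psi> t)"
    unfolding growth_const_def \<Psi>_def power_mult_distrib by (simp only: mult_ac)
  finally show ?thesis .
qed

end

text \<open>A twice differentiable solution. In coordinates \<open>z = (x, y)\<close> the two equations, extrapolated
  crosswise, become a single one.\<close>

locale tikhonov_trajectory = tikhonov_coefficients +
  fixes z z' z'' :: "real \<Rightarrow> 'a"
  assumes z_deriv: "t \<ge> t0 \<Longrightarrow> (z has_vector_derivative z' t) (at t within {t0..})"
    and z'_deriv: "t \<ge> t0 \<Longrightarrow> (z' has_vector_derivative z'' t) (at t within {t0..})"
    and ode: "t \<ge> t0 \<Longrightarrow>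
      z'' t + \<alpha> t *\<^sub>R z' t + \<beta> t *\<^sub>R (G (z t) + A (z t + (\<theta> * t) *\<^sub>R z' t) + \<epsilon> t *\<^sub>R z t) = 0"
begin

lemma continuous_trajectory: "continuous_on {t0..} z" "continuous_on {t0..} z'"
  using z_deriv z'_deriv by (auto intro: continuous_on_vector_derivative)

text \<open>The majorant at time \<open>t\<close> is the energy with anchor frozen at \<open>zt t\<close>, plus the cost of moving the
  anchor. The bound \<open>\<rho> s\<close> on the displacement is differentiable and vanishes at \<open>t\<close>, so the majorant has a
  right derivative although \<^const>\<open>zt\<close> need not have one. The terms linear in the distance \<open>a\<close> and the speed
  \<open>b\<close> are absorbed by the dissipation.\<close>

lemma energy_majorant:
  assumes t: "t \<ge> t0"
  shows "\<exists>V D. (\<forall>s\<ge>t. energy z z' s (zt s) \<le> V s) \<and> V t = energy z z' t (zt t) \<and>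
    (V has_real_derivative D) (at t within {t0..}) \<and> D \<le> growth_const * (t\<^sup>2 * \<Psi> t)"
proof -
  note pos = t_pos[OF t] \<theta>_pos \<beta>_pos[OF t] \<epsilon>_pos[OF t] \<alpha>_pos[OF t] l_pos[OF t] \<Gamma>_pos[OF t]
  let ?F = "at t within {t0..}"
  define \<zeta> where "\<zeta> = zt t"
  define \<rho> where "\<rho> s = (\<epsilon> t - \<epsilon> s) / \<epsilon> s * norm \<zeta>" for s
  define N where "N s = \<theta>\<^sup>2 * s\<^sup>2 * \<beta> s * ((\<epsilon> t - \<epsilon> s) * norm \<zeta> + onorm A * norm (z s - \<zeta>))
     + (\<theta> * s * \<alpha> s - \<theta>) * norm (z s - \<zeta>) + \<theta> * s * norm (z' s)
     + (\<theta> * s * \<alpha> s - \<theta>) / 2 * \<rho> s" for s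
  define q where "q = \<bar>\<epsilon>' t\<bar> / \<epsilon> t * norm \<zeta>"
  define a where "a = norm (z t - \<zeta>)"
  define b where "b = norm (z' t)"
  define V where "V s = energy z z' s \<zeta> + N s * \<rho> s" for s
  have q0: "0 \<le> q"
    using pos by (simp add: q_def)
  have "q \<le> \<bar>\<epsilon>' t\<bar> / \<epsilon> t * norm p"
    unfolding q_def \<zeta>_def using pos by (intro mult_left_mono norm_zt_le t) auto
  note q = q0 this
  have maj: "energy z z' s (zt s) \<le> V s" if "s \<ge> t" for s
  proof -
    have s: "s \<ge> t0"
      using that t by simp
    have \<epsilon>: "\<epsilon> s \<le> \<epsilon> t"
      using \<epsilon>_antimono that t by (auto simp: monotone_on_def)
    have "norm (zt s - \<zeta>) \<le> \<rho> s"
      using zt_diff_le[OF s t] \<epsilon> by (simp add: \<rho>_def \<zeta>_def)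
    then show ?thesis
      unfolding V_def N_def using \<epsilon> s T_zt[OF t] by (intro energy_change_le) (auto simp: \<zeta>_def)
  qed
  have "\<rho> t = 0"
    by (simp add: \<rho>_def)
  then have "V t = energy z z' t (zt t)"
    by (simp add: V_def \<zeta>_def)
  have d\<rho>: "(\<rho> has_real_derivative q) ?F"
  proof -
    have "((\<lambda>s. (\<epsilon> t - \<epsilon> s) / \<epsilon> s * norm \<zeta>) has_real_derivative
        ((0 - \<epsilon>' t) * \<epsilon> t - (\<epsilon> t - \<epsilon> t) * \<epsilon>' t) / (\<epsilon> t * \<epsilon> t) * norm \<zeta>) ?F"
      using pos by (intro DERIV_cmult_right DERIV_divide DERIV_diff DERIV_const \<epsilon>_deriv t) auto
    then show ?thesis
      unfolding \<rho>_def[abs_def] using \<epsilon>'_nonpos[OF t] pos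
      by (elim DERIV_cong) (simp add: q_def)
  qed
  have "continuous_on {t0..} N"
  proof -
    have "\<forall>s\<in>{t0..}. \<epsilon> s \<noteq> 0"
      using \<epsilon>_pos by force
    then show ?thesis
      unfolding N_def[abs_def] \<rho>_def
      by (intro continuous_intros continuous_coefficients continuous_trajectory) simp_all
  qed
  then have "continuous ?F N"
    using t by (simp add: continuous_on_eq_continuous_within)
  from has_real_derivative_mult_zero[OF this d\<rho> \<open>\<rho> t = 0\<close>]
  have dN: "((\<lambda>s. N s * \<rho> s) has_real_derivative N t * q) ?F" .
  obtain D where D: "((\<lambda>s. energy z z' s \<zeta>) has_real_derivative D) ?F"
    "D \<le> \<theta> * t * ((2 * \<theta> - 1) * \<beta> t + \<theta> * t * \<beta>' t) * gap (\<epsilon> t) \<zeta> (z t)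
     + \<theta>\<^sup>2 * t\<^sup>2 * \<beta> t * (\<epsilon>' t / 2 * ((norm (z t))\<^sup>2 - (norm \<zeta>)\<^sup>2))
     - \<theta>\<^sup>2 * t\<^sup>2 * (\<Gamma> t * b\<^sup>2 + l t / 2 * a\<^sup>2)"
    using energy_has_derivative[OF t z_deriv[OF t] z'_deriv[OF t], of \<zeta>]
      energy_derivative_le[OF t ode[OF t], of \<zeta>] unfolding a_def b_def by blast
  have "gap (\<epsilon> t) \<zeta> (z t) \<ge> 0"
    using gap_nonneg_iff[of "\<epsilon> t" \<zeta>] T_zt[OF t] pos by (auto simp: \<zeta>_def)
  then have 1: "\<theta> * t * ((2 * \<theta> - 1) * \<beta> t + \<theta> * t * \<beta>' t) * gap (\<epsilon> t) \<zeta> (z t) \<le> 0"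
    using scaling[OF t] pos by (intro mult_nonpos_nonneg mult_nonneg_nonpos) auto
  have "\<epsilon>' t / 2 * ((norm (z t))\<^sup>2 - (norm \<zeta>)\<^sup>2) \<le> \<epsilon> t * q * a"
  proof -
    have eq: "(norm (z t))\<^sup>2 - (norm \<zeta>)\<^sup>2 = 2 * (\<zeta> \<bullet> (z t - \<zeta>)) + a\<^sup>2"
      by (simp add: a_def power2_norm_eq_inner inner_diff_left inner_diff_right inner_commute)
    have "- (norm \<zeta> * a) \<le> \<zeta> \<bullet> (z t - \<zeta>)"
      using Cauchy_Schwarz_ineq2[of \<zeta> "z t - \<zeta>"] by (simp add: a_def)
    then have "- 2 * (norm \<zeta> * a) \<le> (norm (z t))\<^sup>2 - (norm \<zeta>)\<^sup>2"
      unfolding eq using zero_le_power2[of a] by linarith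
    then have "\<epsilon>' t / 2 * ((norm (z t))\<^sup>2 - (norm \<zeta>)\<^sup>2) \<le> \<epsilon>' t / 2 * (- 2 * (norm \<zeta> * a))"
      using \<epsilon>'_nonpos[OF t] by (intro mult_left_mono_neg) auto
    also have "\<dots> = \<epsilon> t * q * a"
      using \<epsilon>'_nonpos[OF t] pos by (simp add: q_def)
    finally show ?thesis .
  qed
  then have 2: "\<theta>\<^sup>2 * t\<^sup>2 * \<beta> t * (\<epsilon>' t / 2 * ((norm (z t))\<^sup>2 - (norm \<zeta>)\<^sup>2))
      \<le> \<theta>\<^sup>2 * t\<^sup>2 * \<beta> t * (\<epsilon> t * q * a)"
    using pos by (intro mult_left_mono) auto
  define m where "m = \<beta> t * \<epsilon> t + \<beta> t * onorm A + (\<alpha> t - 1 / t) / (\<theta> * t)"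
  have "\<theta>\<^sup>2 * t\<^sup>2 * ((\<alpha> t - 1 / t) / (\<theta> * t)) = \<theta> * t * \<alpha> t - \<theta>"
    using pos by (simp add: field_simps power2_eq_square)
  then have m: "\<theta>\<^sup>2 * t\<^sup>2 * m = \<theta>\<^sup>2 * t\<^sup>2 * \<beta> t * \<epsilon> t + \<theta>\<^sup>2 * t\<^sup>2 * \<beta> t * onorm A + (\<theta> * t * \<alpha> t - \<theta>)"
    unfolding m_def by (simp only: distrib_left mult.assoc)
  have Nt: "N t = \<theta>\<^sup>2 * t\<^sup>2 * \<beta> t * onorm A * a + (\<theta> * t * \<alpha> t - \<theta>) * a + \<theta> * t * b"
    by (simp add: N_def \<open>\<rho> t = 0\<close> a_def b_def)
  have "D + N t * q \<le> \<theta>\<^sup>2 * t\<^sup>2 * \<beta> t * (\<epsilon> t * q * a)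
      - \<theta>\<^sup>2 * t\<^sup>2 * (\<Gamma> t * b\<^sup>2 + l t / 2 * a\<^sup>2) + N t * q"
    using D(2) 1 2 by linarith
  also have "\<dots> = (\<theta>\<^sup>2 * t\<^sup>2 * m) * (q * a) - \<theta>\<^sup>2 * t\<^sup>2 * (l t / 2 * a\<^sup>2)
      + (\<theta> * t * b * q - \<theta>\<^sup>2 * t\<^sup>2 * (\<Gamma> t * b\<^sup>2))"
    unfolding m Nt by (simp add: algebra_simps)
  also have "\<dots> = \<theta>\<^sup>2 * t\<^sup>2 * (m * q * a - l t / 2 * a\<^sup>2)
      + (q * (\<theta> * t * b) - (2 * \<Gamma> t) / 2 * (\<theta> * t * b)\<^sup>2)"
    by (simp add: algebra_simps power_mult_distrib)
  also have "\<dots> \<le> \<theta>\<^sup>2 * t\<^sup>2 * ((drift_const * H t * q)\<^sup>2 / (2 * l t)) + q\<^sup>2 / (2 * (2 * \<Gamma> t))"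
  proof (intro add_mono mult_left_mono)
    have "m * q * a \<le> drift_const * H t * q * a"
      unfolding m_def a_def using q by (intro mult_right_mono drift_le t) auto
    then show "m * q * a - l t / 2 * a\<^sup>2 \<le> (drift_const * H t * q)\<^sup>2 / (2 * l t)"
      using quadratic_le[OF l_pos[OF t], of "drift_const * H t * q" a] by linarith
    show "q * (\<theta> * t * b) - 2 * \<Gamma> t / 2 * (\<theta> * t * b)\<^sup>2 \<le> q\<^sup>2 / (2 * (2 * \<Gamma> t))"
      using pos by (intro quadratic_le) simp
  qed simp
  also have "\<dots> = t\<^sup>2 * ((\<theta>\<^sup>2 * drift_const\<^sup>2 / 2) * ((H t)\<^sup>2 / l t) + 1 / 4 * (1 / (t\<^sup>2 * \<Gamma> t))) * q\<^sup>2"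
    using pos by (simp add: power_mult_distrib distrib_left distrib_right)
  also have "\<dots> \<le> growth_const * (t\<^sup>2 * \<Psi> t)"
    by (intro growth_const_bound t q) auto
  finally have "D + N t * q \<le> growth_const * (t\<^sup>2 * \<Psi> t)" .
  moreover have "(V has_real_derivative D + N t * q) ?F"
    unfolding V_def[abs_def] by (intro DERIV_add D(1) dN)
  ultimately show ?thesis
    using maj \<open>V t = energy z z' t (zt t)\<close> by blast
qed

lemma energy_growth:
  assumes t: "t \<ge> t0"
  shows "energy z z' t (zt t) \<le> energy z z' t0 (zt t0) + growth_const * integral {t0..t} (\<lambda>\<tau>. \<tau>\<^sup>2 * \<Psi> \<tau>)"
proof -
  have \<phi>: "continuous_on UNIV \<phi>"
    using grad by (auto simp: continuous_on_eq_continuous_at gderiv_def intro: has_derivative_continuous)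
  have "continuous_on {t0..} (\<lambda>s. energy z z' s (zt s))"
    unfolding energy_def gap_def
    by (intro continuous_intros continuous_coefficients continuous_trajectory continuous_zt
        continuous_on_compose2[OF \<phi>] continuous_on_compose2[OF linear_continuous_on[OF lin]]) auto
  then have E: "continuous_on {t0..t} (\<lambda>s. energy z z' s (zt s))"
    by (rule continuous_on_subset) auto
  have "continuous_on {t0..} (\<lambda>\<tau>. growth_const * (\<tau>\<^sup>2 * \<Psi> \<tau>))"
    by (intro continuous_intros continuous_\<Psi>)
  then have g: "continuous_on {t0..t} (\<lambda>\<tau>. growth_const * (\<tau>\<^sup>2 * \<Psi> \<tau>))"
    by (rule continuous_on_subset) auto
  have "energy z z' t (zt t) \<le> energy z z' t0 (zt t0)
      + integral {t0..t} (\<lambda>\<tau>. growth_const * (\<tau>\<^sup>2 * \<Psi> \<tau>))"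
  proof (rule right_majorant_le_integral[OF t E g])
    fix s assume s: "t0 \<le> s" "s < t"
    from energy_majorant[OF s(1)] obtain V D where V: "\<forall>r\<ge>s. energy z z' r (zt r) \<le> V r"
      "V s = energy z z' s (zt s)" "(V has_real_derivative D) (at s within {t0..})"
      "D \<le> growth_const * (s\<^sup>2 * \<Psi> s)"
      by blast
    then show "\<exists>V D. (\<forall>r\<in>{s..t}. energy z z' r (zt r) \<le> V r) \<and> V s = energy z z' s (zt s) \<and>
        (V has_real_derivative D) (at s within {s..t}) \<and> D \<le> growth_const * (s\<^sup>2 * \<Psi> s)"
      using s by (intro exI[of _ V] exI[of _ D]) (auto intro: DERIV_subset)
  qed
  then show ?thesis
    by simp
qed

lemma energy_ge:
  assumes t: "t \<ge> t0"
  shows "\<theta>\<^sup>2 / 2 * (t\<^sup>2 * \<beta> t * \<epsilon> t) * (norm (z t - zt t))\<^sup>2 \<le> energy z z' t (zt t)"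
proof -
  note pos = t_pos[OF t] \<theta>_pos \<beta>_pos[OF t]
  have "\<theta>\<^sup>2 * t\<^sup>2 * \<beta> t * (\<epsilon> t / 2 * (norm (z t - zt t))\<^sup>2) \<le> \<theta>\<^sup>2 * t\<^sup>2 * \<beta> t * gap (\<epsilon> t) (zt t) (z t)"
    using pos by (intro mult_left_mono gap_zero_ge T_zt t) auto
  moreover have "0 \<le> (\<theta> * t * \<alpha> t - 1 - \<theta>) / 2 * (norm (z t - zt t))\<^sup>2"
    using damping[OF t] by (intro mult_nonneg_nonneg) auto
  moreover have "0 \<le> (norm (z t - zt t + (\<theta> * t) *\<^sub>R z' t))\<^sup>2 / 2"
    by simp
  moreover have "\<theta>\<^sup>2 / 2 * (t\<^sup>2 * \<beta> t * \<epsilon> t) * (norm (z t - zt t))\<^sup>2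
      = \<theta>\<^sup>2 * t\<^sup>2 * \<beta> t * (\<epsilon> t / 2 * (norm (z t - zt t))\<^sup>2)"
    by simp
  ultimately show ?thesis
    unfolding energy_def by linarith
qed

lemma trajectory_tendsto_zt:
  assumes growth: "filterlim (\<lambda>t. t\<^sup>2 * \<beta> t * \<epsilon> t) at_top at_top"
    and \<Psi>_lim: "((\<lambda>t. integral {t0..t} (\<lambda>\<tau>. \<tau>\<^sup>2 * \<Psi> \<tau>) / (t\<^sup>2 * \<beta> t * \<epsilon> t)) \<longlongrightarrow> 0) at_top"
  shows "((\<lambda>t. z t - zt t) \<longlongrightarrow> 0) at_top"
proof -
  let ?w = "\<lambda>t. t\<^sup>2 * \<beta> t * \<epsilon> t" and ?I = "\<lambda>t. integral {t0..t} (\<lambda>\<tau>. \<tau>\<^sup>2 * \<Psi> \<tau>)"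
  define E0 where "E0 = energy z z' t0 (zt t0)"
  have "((\<lambda>t. E0 / ?w t) \<longlongrightarrow> 0) at_top"
    by (rule tendsto_divide_0[OF tendsto_const filterlim_at_top_imp_at_infinity[OF growth]])
  from tendsto_mult_left[OF tendsto_add[OF this tendsto_mult_left[OF \<Psi>_lim, of growth_const]], of "2 / \<theta>\<^sup>2"]
  have lim: "((\<lambda>t. 2 / \<theta>\<^sup>2 * (E0 / ?w t + growth_const * (?I t / ?w t))) \<longlongrightarrow> 0) at_top"
    by simp
  have "eventually (\<lambda>t. norm ((norm (z t - zt t))\<^sup>2) \<le> 2 / \<theta>\<^sup>2 * (E0 / ?w t + growth_const * (?I t / ?w t))) at_top"
    using eventually_ge_at_top[of t0]
  proof eventually_elim
    case (elim t)
    have w: "?w t > 0"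
      using t_pos[OF elim] \<beta>_pos[OF elim] \<epsilon>_pos[OF elim] by simp
    have "\<theta>\<^sup>2 / 2 * ?w t * (norm (z t - zt t))\<^sup>2 \<le> E0 + growth_const * ?I t"
      using energy_ge[OF elim] energy_growth[OF elim] unfolding E0_def by linarith
    then have "(norm (z t - zt t))\<^sup>2 \<le> (E0 + growth_const * ?I t) / (\<theta>\<^sup>2 / 2 * ?w t)"
    proof (subst pos_le_divide_eq)
      show "0 < \<theta>\<^sup>2 / 2 * ?w t"
        using \<theta>_pos by (intro mult_pos_pos w) simp
    qed (simp add: mult_ac)
    also have "\<dots> = 2 / \<theta>\<^sup>2 * (E0 / ?w t + growth_const * (?I t / ?w t))"
      using \<theta>_pos by (simp add: add_divide_distrib distrib_left mult_ac)
    finally show ?case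
      by simp
  qed
  then have "((\<lambda>t. (norm (z t - zt t))\<^sup>2) \<longlongrightarrow> 0) at_top"
    by (rule Lim_null_comparison[OF _ lim])
  then have "((\<lambda>t. sqrt ((norm (z t - zt t))\<^sup>2)) \<longlongrightarrow> sqrt 0) at_top"
    by (rule tendsto_real_sqrt)
  then show ?thesis
    by (simp add: tendsto_norm_zero_iff)
qed

end

section \<open>The residual of the path of regularized saddle points\<close>

context tikhonov_coefficients
begin

text \<open>The perturbation that arises from a velocity \<open>d\<close> of the regularized saddle point.\<close>

definition P :: "'a \<Rightarrow> real \<Rightarrow> 'a" where
  "P d t = - (\<beta> t *\<^sub>R A d) - (\<beta> t * \<epsilon>' t) *\<^sub>R zt t + ((\<alpha> t - 1 / t) / (\<theta> * t)) *\<^sub>R d"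

text \<open>The function \<open>\<R>\<close> at time \<open>t\<close>, as a function of the velocity \<open>d\<close> of the regularized saddle
  point.\<close>

definition residual :: "'a \<Rightarrow> real \<Rightarrow> real" where
  "residual d t = (norm (P d t))\<^sup>2 / l t + (norm d)\<^sup>2 / (2 * \<theta>\<^sup>2 * t\<^sup>2 * \<Gamma> t)"

lemma zt_derivative_norm_le:
  assumes t: "t \<ge> t0" and d: "(zt has_vector_derivative d) (at t)"
  shows "norm d \<le> \<bar>\<epsilon>' t\<bar> / \<epsilon> t * norm (zt t)"
proof (rule tendsto_le[of "at_right t"])
  have "((\<lambda>s. (1 / (s - t)) *\<^sub>R (zt s - zt t)) \<longlongrightarrow> d) (at_right t)"
    by (rule has_vector_derivative_tendsto_quotient[OF has_vector_derivative_at_within[OF d]])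
  then show "((\<lambda>s. norm ((1 / (s - t)) *\<^sub>R (zt s - zt t))) \<longlongrightarrow> norm d) (at_right t)"
    by (rule tendsto_norm)
  have \<epsilon>_right: "(\<epsilon> has_real_derivative \<epsilon>' t) (at_right t)"
    using t by (intro DERIV_subset[OF \<epsilon>_deriv]) auto
  then have "((\<lambda>s. (\<epsilon> s - \<epsilon> t) / (s - t)) \<longlongrightarrow> \<epsilon>' t) (at_right t)"
    by (simp add: has_field_derivative_iff)
  moreover have "(\<epsilon> \<longlongrightarrow> \<epsilon> t) (at_right t)"
    using DERIV_continuous[OF \<epsilon>_right] by (simp add: continuous_within)
  ultimately show "((\<lambda>s. \<bar>(\<epsilon> s - \<epsilon> t) / (s - t)\<bar> / \<epsilon> s * norm (zt t))
      \<longlongrightarrow> \<bar>\<epsilon>' t\<bar> / \<epsilon> t * norm (zt t)) (at_right t)"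
    using \<epsilon>_pos[OF t] by (intro tendsto_intros) auto
  have "norm ((1 / (s - t)) *\<^sub>R (zt s - zt t)) \<le> \<bar>(\<epsilon> s - \<epsilon> t) / (s - t)\<bar> / \<epsilon> s * norm (zt t)"
    if "s > t" for s
  proof -
    have "norm ((1 / (s - t)) *\<^sub>R (zt s - zt t)) = (1 / (s - t)) * norm (zt s - zt t)"
      using that by simp
    also have "\<dots> \<le> (1 / (s - t)) * (\<bar>\<epsilon> t - \<epsilon> s\<bar> / \<epsilon> s * norm (zt t))"
      using zt_diff_le[of s t] that t by (intro mult_left_mono) auto
    also have "\<dots> = \<bar>(\<epsilon> s - \<epsilon> t) / (s - t)\<bar> / \<epsilon> s * norm (zt t)"
      using that by (simp add: abs_minus_commute)
    finally show ?thesis .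
  qed
  then show "eventually (\<lambda>s. norm ((1 / (s - t)) *\<^sub>R (zt s - zt t))
      \<le> \<bar>(\<epsilon> s - \<epsilon> t) / (s - t)\<bar> / \<epsilon> s * norm (zt t)) (at_right t)"
    by (auto simp: eventually_at_filter intro!: always_eventually)
qed simp

lemma residual_nonneg: "t \<ge> t0 \<Longrightarrow> 0 \<le> residual d t"
  using l_pos[of t] \<Gamma>_pos[of t] by (simp add: residual_def)

lemma residual_le:
  assumes t: "t \<ge> t0" and d: "(zt has_vector_derivative d) (at t)"
  shows "t\<^sup>2 * residual d t \<le> growth_const * (t\<^sup>2 * \<Psi> t)"
proof -
  note pos = t_pos[OF t] \<theta>_pos \<beta>_pos[OF t] \<epsilon>_pos[OF t] l_pos[OF t] \<Gamma>_pos[OF t]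
  define q where "q = \<bar>\<epsilon>' t\<bar> / \<epsilon> t * norm (zt t)"
  have q0: "0 \<le> q"
    using pos by (simp add: q_def)
  have "q \<le> \<bar>\<epsilon>' t\<bar> / \<epsilon> t * norm p"
    unfolding q_def using pos by (intro mult_left_mono norm_zt_le t) auto
  note q = q0 this
  have dq: "norm d \<le> q"
    unfolding q_def by (rule zt_derivative_norm_le[OF t d])
  have "norm (P d t) \<le> norm (\<beta> t *\<^sub>R A d) + norm ((\<beta> t * \<epsilon>' t) *\<^sub>R zt t)
      + norm (((\<alpha> t - 1 / t) / (\<theta> * t)) *\<^sub>R d)"
    unfolding P_def
    using norm_triangle_ineq[of "- (\<beta> t *\<^sub>R A d) - (\<beta> t * \<epsilon>' t) *\<^sub>R zt t" "((\<alpha> t - 1 / t) / (\<theta> * t)) *\<^sub>R d"]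
      norm_triangle_ineq4[of "- (\<beta> t *\<^sub>R A d)" "(\<beta> t * \<epsilon>' t) *\<^sub>R zt t"]
    unfolding norm_minus_cancel by linarith
  also have "\<dots> \<le> \<beta> t * (onorm A * q) + \<beta> t * \<epsilon> t * q + (\<alpha> t - 1 / t) / (\<theta> * t) * q"
  proof (intro add_mono)
    have "norm (A d) \<le> onorm A * q"
      using onorm[OF lin, of d] mult_left_mono[OF dq onorm_pos_le[OF lin]] by linarith
    then show "norm (\<beta> t *\<^sub>R A d) \<le> \<beta> t * (onorm A * q)"
      using pos by (simp add: mult_left_mono)
    show "norm ((\<beta> t * \<epsilon>' t) *\<^sub>R zt t) \<le> \<beta> t * \<epsilon> t * q"
      using pos by (simp add: q_def abs_mult)
    show "norm (((\<alpha> t - 1 / t) / (\<theta> * t)) *\<^sub>R d) \<le> (\<alpha> t - 1 / t) / (\<theta> * t) * q"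
      unfolding norm_scaleR abs_of_nonneg[OF drift_coefficient_nonneg[OF t]]
      by (intro mult_left_mono dq drift_coefficient_nonneg t)
  qed
  also have "\<dots> = (\<beta> t * \<epsilon> t + \<beta> t * onorm A + (\<alpha> t - 1 / t) / (\<theta> * t)) * q"
    by (simp only: distrib_right mult.assoc add_ac)
  also have "\<dots> \<le> drift_const * H t * q"
    by (intro mult_right_mono drift_le t q)
  finally have "(norm (P d t))\<^sup>2 / l t \<le> (drift_const * H t * q)\<^sup>2 / l t"
    using pos by (intro divide_right_mono power_mono) auto
  moreover have "(norm d)\<^sup>2 / (2 * \<theta>\<^sup>2 * t\<^sup>2 * \<Gamma> t) \<le> q\<^sup>2 / (2 * \<theta>\<^sup>2 * t\<^sup>2 * \<Gamma> t)"
    using pos dq by (intro divide_right_mono power_mono) auto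
  ultimately have "residual d t \<le> (drift_const * H t * q)\<^sup>2 / l t + q\<^sup>2 / (2 * \<theta>\<^sup>2 * t\<^sup>2 * \<Gamma> t)"
    unfolding residual_def by (rule add_mono)
  also have "\<dots> = (drift_const\<^sup>2 * ((H t)\<^sup>2 / l t) + 1 / (2 * \<theta>\<^sup>2) * (1 / (t\<^sup>2 * \<Gamma> t))) * q\<^sup>2"
    unfolding distrib_right by (simp add: power_mult_distrib mult_ac)
  finally have "t\<^sup>2 * residual d t
      \<le> t\<^sup>2 * ((drift_const\<^sup>2 * ((H t)\<^sup>2 / l t) + 1 / (2 * \<theta>\<^sup>2) * (1 / (t\<^sup>2 * \<Gamma> t))) * q\<^sup>2)"
    by (rule mult_left_mono) simp
  also have "\<dots> = t\<^sup>2 * (drift_const\<^sup>2 * ((H t)\<^sup>2 / l t) + 1 / (2 * \<theta>\<^sup>2) * (1 / (t\<^sup>2 * \<Gamma> t))) * q\<^sup>2"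
    by (rule mult.assoc[symmetric])
  also have "\<dots> \<le> growth_const * (t\<^sup>2 * \<Psi> t)"
    by (intro growth_const_bound t q) auto
  finally show ?thesis .
qed

lemma zt_lipschitz:
  assumes b: "t0 \<le> b"
  obtains B where "B-lipschitz_on {t0..b} zt"
proof -
  have "compact (\<epsilon>' ` {t0..b})"
    by (intro compact_continuous_image continuous_on_subset[OF \<epsilon>'_cont]) auto
  then obtain B where B: "\<And>t. t \<in> {t0..b} \<Longrightarrow> norm (\<epsilon>' t) \<le> B"
    by (meson bounded_iff compact_imp_bounded imageI)
  have B0: "0 \<le> B"
    using order_trans[OF norm_ge_zero B[of t0]] b by simp
  have \<epsilon>_lip: "\<bar>\<epsilon> s - \<epsilon> t\<bar> \<le> B * \<bar>s - t\<bar>" if "s \<in> {t0..b}" "t \<in> {t0..b}" for s t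
  proof -
    have "norm (\<epsilon> s - \<epsilon> t) \<le> B * norm (s - t)"
    proof (rule field_differentiable_bound[OF convex_real_interval(5)])
      show "(\<epsilon> has_real_derivative \<epsilon>' r) (at r within {t0..b})" if "r \<in> {t0..b}" for r
        using that by (intro DERIV_subset[OF \<epsilon>_deriv]) auto
    qed (use B that in auto)
    then show ?thesis
      by simp
  qed
  have "(B / \<epsilon> b * norm p)-lipschitz_on {t0..b} zt"
  proof (rule lipschitz_onI)
    fix s t assume st: "s \<in> {t0..b}" "t \<in> {t0..b}"
    have \<epsilon>s: "\<epsilon> b \<le> \<epsilon> s"
      using \<epsilon>_antimono st by (auto simp: monotone_on_def)
    have "norm (zt s - zt t) \<le> \<bar>\<epsilon> t - \<epsilon> s\<bar> / \<epsilon> s * norm (zt t)"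
      using st by (intro zt_diff_le) auto
    also have "\<dots> \<le> (B * \<bar>s - t\<bar>) / \<epsilon> b * norm p"
      using \<epsilon>_lip[OF st] \<epsilon>s \<epsilon>_pos[of b] b norm_zt_le[of t] st B0
      by (intro mult_mono frac_le) (auto simp: abs_minus_commute)
    finally show "dist (zt s) (zt t) \<le> B / \<epsilon> b * norm p * dist s t"
      by (simp add: dist_norm mult_ac)
  qed (use B0 \<epsilon>_pos[of b] b in auto)
  then show thesis
    by (rule that)
qed

text \<open>Lipschitz continuity holds on compact intervals only, hence the clamped extension to the real
  line in the proof.\<close>

lemma zt_differentiable_AE:
  assumes b: "t0 \<le> b"
  obtains N where "negligible N" "\<And>t. \<lbrakk>t0 < t; t < b; t \<notin> N\<rbrakk> \<Longrightarrow> zt differentiable (at t)"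
proof -
  obtain B where B: "B-lipschitz_on {t0..b} zt"
    using zt_lipschitz[OF b] by blast
  define F where "F t = zt (max t0 (min b t))" for t
  have "B-lipschitz_on UNIV F"
  proof (rule lipschitz_onI)
    fix s t :: real
    have "dist (F s) (F t) \<le> B * dist (max t0 (min b s)) (max t0 (min b t))"
      unfolding F_def using b by (intro lipschitz_onD[OF B]) auto
    also have "\<dots> \<le> B * dist s t"
      using lipschitz_on_nonneg[OF B] by (intro mult_left_mono) (auto simp: dist_real_def)
    finally show "dist (F s) (F t) \<le> B * dist s t" .
  qed (rule lipschitz_on_nonneg[OF B])
  then obtain N where N: "negligible N" "\<And>t. t \<notin> N \<Longrightarrow> F differentiable (at t)"
    using lipschitz_vector_differentiable_AE by blast
  have "zt differentiable (at t)" if t: "t0 < t" "t < b" "t \<notin> N" for t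
  proof -
    obtain D where "(F has_derivative D) (at t)"
      using N(2)[OF t(3)] by (auto simp: differentiable_def)
    then have "(zt has_derivative D) (at t)"
      by (rule has_derivative_transform_within_open[of _ _ _ _ "{t0<..<b}"])
        (use t in \<open>auto simp: F_def\<close>)
    then show ?thesis
      by (auto simp: differentiable_def)
  qed
  then show thesis
    using that N(1) by blast
qed

text \<open>The residual is dominated by a multiple of \<^const>\<open>\<Psi>\<close> off a null set, and it is measurable because
  the velocity is a limit of continuous difference quotients there. Nothing is assumed about \<open>dz\<close> on the
  null set.\<close>

lemma residual_integrable:
  assumes dz: "\<And>t. \<lbrakk>t0 < t; zt differentiable (at t)\<rbrakk> \<Longrightarrow> (zt has_vector_derivative dz t) (at t)"
    and b: "t0 \<le> b"
  shows "(\<lambda>t. t\<^sup>2 * residual (dz t) t) absolutely_integrable_on {t0..b}"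
    and "integral {t0..b} (\<lambda>t. t\<^sup>2 * residual (dz t) t) \<le> growth_const * integral {t0..b} (\<lambda>t. t\<^sup>2 * \<Psi> t)"
proof -
  let ?f = "\<lambda>t. t\<^sup>2 * residual (dz t) t" and ?g = "\<lambda>t. growth_const * (t\<^sup>2 * \<Psi> t)"
  obtain N where N: "negligible N" "\<And>t. \<lbrakk>t0 < t; t < b; t \<notin> N\<rbrakk> \<Longrightarrow> zt differentiable (at t)"
    using zt_differentiable_AE[OF b] by blast
  define S where "S = {t0<..<b} - N"
  have S: "S \<in> sets lebesgue" "S \<subseteq> {t0..b}"
    using N(1) by (auto simp: S_def negligible_iff_null_sets)
  have negl: "negligible ({t0..b} - S)"
    by (rule negligible_subset[of "N \<union> {t0, b}"]) (use N(1) in \<open>auto simp: S_def\<close>)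
  have spike: "negligible {t \<in> S - {t0..b}. h t \<noteq> 0}" "negligible {t \<in> {t0..b} - S. h t \<noteq> 0}"
    for h :: "real \<Rightarrow> real"
  proof -
    have "{t \<in> S - {t0..b}. h t \<noteq> 0} = {}"
      using S(2) by blast
    then show "negligible {t \<in> S - {t0..b}. h t \<noteq> 0}"
      by (simp only: negligible_empty)
    show "negligible {t \<in> {t0..b} - S. h t \<noteq> 0}"
      by (rule negligible_subset[OF negl]) auto
  qed
  have d: "(zt has_vector_derivative dz t) (at t)" if "t \<in> S" for t
    using that by (intro dz N) (auto simp: S_def)
  have cont: "h \<in> borel_measurable (lebesgue_on S)" if "continuous_on {t0..} h"
    for h :: "real \<Rightarrow> 'b::euclidean_space"
    using S that by (intro continuous_imp_measurable_on_sets_lebesgue continuous_on_subset[OF that]) auto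
  have dz_meas: "dz \<in> borel_measurable (lebesgue_on S)"
  proof (rule borel_measurable_LIMSEQ_metric)
    fix n :: nat
    show "(\<lambda>t. real (Suc n) *\<^sub>R (zt (t + inverse (real (Suc n))) - zt t)) \<in> borel_measurable (lebesgue_on S)"
    proof (rule cont)
      have "inverse (real (Suc n)) \<ge> 0"
        by simp
      then show "continuous_on {t0..} (\<lambda>t. real (Suc n) *\<^sub>R (zt (t + inverse (real (Suc n))) - zt t))"
        by (intro continuous_intros continuous_on_compose2[OF continuous_zt]) (auto intro: add_increasing2)
    qed
  next
    fix t assume "t \<in> space (lebesgue_on S)"
    then have "(zt has_vector_derivative dz t) (at t)"
      using d by simp
    then have "((\<lambda>s. (1 / (s - t)) *\<^sub>R (zt s - zt t)) \<longlongrightarrow> dz t) (at t)"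
      by (rule has_vector_derivative_tendsto_quotient)
    moreover have "filterlim (\<lambda>n. t + inverse (real (Suc n))) (at t) sequentially"
    proof -
      have "(\<lambda>n. t + inverse (real (Suc n))) \<longlonglongrightarrow> t + 0"
        by (intro tendsto_intros LIMSEQ_inverse_real_of_nat)
      then show ?thesis
        by (auto simp: filterlim_at)
    qed
    ultimately have "(\<lambda>n. (1 / (t + inverse (real (Suc n)) - t)) *\<^sub>R (zt (t + inverse (real (Suc n))) - zt t))
        \<longlonglongrightarrow> dz t"
      by (rule filterlim_compose)
    then show "(\<lambda>n. real (Suc n) *\<^sub>R (zt (t + inverse (real (Suc n))) - zt t)) \<longlonglongrightarrow> dz t"
      by (simp add: divide_inverse del: of_nat_Suc)
  qed
  have A_meas: "(\<lambda>t. A (dz t)) \<in> borel_measurable (lebesgue_on S)"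
    by (rule measurable_compose[OF dz_meas borel_measurable_continuous_onI[OF linear_continuous_on[OF lin]]])
  have ne: "\<forall>t\<in>{t0..}. t \<noteq> 0" "\<forall>t\<in>{t0..}. \<theta> * t \<noteq> 0" "\<forall>t\<in>{t0..}. l t \<noteq> 0"
      "\<forall>t\<in>{t0..}. 2 * \<theta>\<^sup>2 * t\<^sup>2 * \<Gamma> t \<noteq> 0"
    using t_pos \<theta>_pos l_pos \<Gamma>_pos by force+
  have f_meas: "?f \<in> borel_measurable (lebesgue_on S)"
  proof -
    have [measurable]: "(\<lambda>t. t\<^sup>2) \<in> borel_measurable (lebesgue_on S)"
      "\<beta> \<in> borel_measurable (lebesgue_on S)" "(\<lambda>t. \<beta> t * \<epsilon>' t) \<in> borel_measurable (lebesgue_on S)"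
      "zt \<in> borel_measurable (lebesgue_on S)"
      "(\<lambda>t. (\<alpha> t - 1 / t) / (\<theta> * t)) \<in> borel_measurable (lebesgue_on S)"
      "l \<in> borel_measurable (lebesgue_on S)"
      "(\<lambda>t. 2 * \<theta>\<^sup>2 * t\<^sup>2 * \<Gamma> t) \<in> borel_measurable (lebesgue_on S)"
      using ne by (intro cont continuous_intros continuous_coefficients \<epsilon>'_cont continuous_zt
          continuous_l continuous_\<Gamma>; simp)+
    note [measurable] = dz_meas A_meas
    show ?thesis
      unfolding residual_def P_def by measurable
  qed
  have g_cont: "continuous_on {t0..b} ?g"
    by (intro continuous_intros continuous_on_subset[OF continuous_\<Psi>]) auto
  then have g: "?g absolutely_integrable_on {t0..b}"
    by (rule absolutely_integrable_continuous_real)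
  then have gS: "?g integrable_on S"
    using S set_integrable_subset set_lebesgue_integral_eq_integral(1) by blast
  have fg: "0 \<le> ?f t" "?f t \<le> ?g t" if "t \<in> S" for t
    using that S(2) residual_nonneg[of t] residual_le[OF _ d[OF that]] by auto
  have fS: "?f integrable_on S"
    by (rule measurable_bounded_by_integrable_imp_integrable_real[OF f_meas gS _ S(1)])
      (use fg in \<open>simp add: abs_of_nonneg\<close>)
  then have "?f absolutely_integrable_on S"
    by (rule nonnegative_absolutely_integrable_1) (use fg in auto)
  then show f: "?f absolutely_integrable_on {t0..b}"
    by (rule absolutely_integrable_spike_set) (rule spike)+
  have "integral {t0..b} ?f = integral S ?f" "integral {t0..b} ?g = integral S ?g"
    by (rule integral_spike_set; rule spike)+
  moreover have "integral S ?f \<le> integral S ?g"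
    by (rule integral_le[OF fS gS fg(2)])
  ultimately have "integral {t0..b} ?f \<le> integral {t0..b} ?g"
    by (simp only:)
  then show "integral {t0..b} ?f \<le> growth_const * integral {t0..b} (\<lambda>t. t\<^sup>2 * \<Psi> t)"
    by simp
qed

lemma residual_tendsto:
  assumes dz: "\<And>t. \<lbrakk>t0 < t; zt differentiable (at t)\<rbrakk> \<Longrightarrow> (zt has_vector_derivative dz t) (at t)"
    and \<Psi>_lim: "((\<lambda>t. integral {t0..t} (\<lambda>\<tau>. \<tau>\<^sup>2 * \<Psi> \<tau>) / (t\<^sup>2 * \<beta> t * \<epsilon> t)) \<longlongrightarrow> 0) at_top"
  shows "((\<lambda>t. integral {t0..t} (\<lambda>\<tau>. \<tau>\<^sup>2 * residual (dz \<tau>) \<tau>) / (t\<^sup>2 * \<beta> t * \<epsilon> t)) \<longlongrightarrow> 0) at_top"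
proof (rule Lim_null_comparison)
  show "((\<lambda>t. growth_const * (integral {t0..t} (\<lambda>\<tau>. \<tau>\<^sup>2 * \<Psi> \<tau>) / (t\<^sup>2 * \<beta> t * \<epsilon> t))) \<longlongrightarrow> 0) at_top"
    using tendsto_mult_left[OF \<Psi>_lim, of growth_const] by simp
  show "eventually (\<lambda>t. norm (integral {t0..t} (\<lambda>\<tau>. \<tau>\<^sup>2 * residual (dz \<tau>) \<tau>) / (t\<^sup>2 * \<beta> t * \<epsilon> t))
      \<le> growth_const * (integral {t0..t} (\<lambda>\<tau>. \<tau>\<^sup>2 * \<Psi> \<tau>) / (t\<^sup>2 * \<beta> t * \<epsilon> t))) at_top"
    using eventually_ge_at_top[of t0]
  proof eventually_elim
    case (elim t)
    have w: "t\<^sup>2 * \<beta> t * \<epsilon> t > 0"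
      using t_pos[OF elim] \<beta>_pos[OF elim] \<epsilon>_pos[OF elim] by simp
    have "0 \<le> integral {t0..t} (\<lambda>\<tau>. \<tau>\<^sup>2 * residual (dz \<tau>) \<tau>)"
      using residual_nonneg residual_integrable(1)[OF dz elim]
      by (intro integral_nonneg) (auto simp: set_lebesgue_integral_eq_integral(1))
    then show ?case
      using residual_integrable(2)[OF dz elim] w by (simp add: divide_right_mono)
  qed
qed

end

section \<open>Strong solutions and Lagrangians\<close>

lemma W11_loc_deriv_eq_integral:
  "\<lbrakk>W11_loc_deriv t0 u u'; t0 \<le> t\<rbrakk> \<Longrightarrow> u t = u t0 + integral {t0..t} u'"
  unfolding W11_loc_deriv_def by blast

lemma W11_loc_deriv_continuous:
  assumes "W11_loc_deriv t0 u u'"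
  shows "continuous_on {t0..} u"
  unfolding continuous_on_def
proof
  fix t assume t: "t \<in> {t0..}"
  have int: "u' integrable_on {t0..t + 1}"
    using assms t unfolding W11_loc_deriv_def
    by (auto intro!: set_lebesgue_integral_eq_integral(1))
  have "continuous_on {t0..t + 1} (\<lambda>s. u t0 + integral {t0..s} u')"
    by (intro continuous_intros indefinite_integral_continuous_1 int)
  then have "continuous_on {t0..t + 1} u"
    by (rule continuous_on_eq) (rule W11_loc_deriv_eq_integral[OF assms, symmetric], simp)
  then have "(u \<longlongrightarrow> u t) (at t within {t0..t + 1})"
    using t by (simp add: continuous_on_def)
  moreover have "at t within {t0..} = at t within {t0..t + 1}"
    by (rule at_within_nhd[of _ "{..<t + 1}"]) auto
  ultimately show "(u \<longlongrightarrow> u t) (at t within {t0..})"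
    by simp
qed

text \<open>If the weak derivative agrees almost everywhere with a continuous function, the function is
  continuously differentiable.\<close>

lemma W11_loc_deriv_has_vector_derivative:
  assumes u: "W11_loc_deriv t0 u u'"
    and h: "continuous_on {t0..} h" and eq: "AE t in lebesgue. t > t0 \<longrightarrow> u' t = h t" and t: "t \<ge> t0"
  shows "(u has_vector_derivative h t) (at t within {t0..})"
proof -
  obtain N where N: "N \<in> null_sets lebesgue" "\<And>t. t \<notin> N \<Longrightarrow> t > t0 \<longrightarrow> u' t = h t"
    using eq by (auto elim: AE_E3)
  have u_eq: "u s = u t0 + integral {t0..s} h" if "s \<ge> t0" for s
  proof -
    have "integral {t0..s} u' = integral {t0..s} h"
      by (rule integral_spike[of "N \<union> {t0}"]) (use N in \<open>auto simp: negligible_iff_null_sets\<close>)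
    then show ?thesis
      using W11_loc_deriv_eq_integral[OF u that] by simp
  qed
  have "continuous_on {t0..t + 1} h"
    using h by (rule continuous_on_subset) auto
  then have "((\<lambda>s. integral {t0..s} h) has_vector_derivative h t) (at t within {t0..t + 1})"
    using t by (intro integral_has_vector_derivative) auto
  then have "((\<lambda>s. u t0 + integral {t0..s} h) has_vector_derivative 0 + h t) (at t within {t0..t + 1})"
    by (intro has_vector_derivative_add has_vector_derivative_const)
  moreover have "at t within {t0..} = at t within {t0..t + 1}"
    by (rule at_within_nhd[of _ "{..<t + 1}"]) auto
  ultimately have "((\<lambda>s. u t0 + integral {t0..s} h) has_vector_derivative h t) (at t within {t0..})"
    by simp
  then show ?thesis
    by (rule has_vector_derivative_transform[rotated 2]) (use t in simp, rule u_eq, simp)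
qed

text \<open>The differential equation expresses the second derivatives, almost everywhere, by continuous
  functions. Strong solutions are therefore classical.\<close>

lemma gtrd_trajectory_classical:
  fixes x :: "real \<Rightarrow> real^'n" and y :: "real \<Rightarrow> real^'m"
  assumes traj: "gtrd_trajectory t0 \<theta> \<alpha> \<beta> \<epsilon> gf gg K x y"
    and cont: "continuous_on {t0..} \<alpha>" "continuous_on {t0..} \<beta>" "continuous_on {t0..} \<epsilon>"
      "continuous_on UNIV gf" "continuous_on UNIV gg"
  obtains x' y' where
    "\<And>t. t \<ge> t0 \<Longrightarrow> (x has_vector_derivative x' t) (at t within {t0..})"
    "\<And>t. t \<ge> t0 \<Longrightarrow> (y has_vector_derivative y' t) (at t within {t0..})"
    "\<And>t. t \<ge> t0 \<Longrightarrow> (x' has_vector_derivative - (\<alpha> t *\<^sub>R x' t)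
        - \<beta> t *\<^sub>R grad_x_reg gf K (\<epsilon> t) (x t) (y t + (\<theta> * t) *\<^sub>R y' t)) (at t within {t0..})"
    "\<And>t. t \<ge> t0 \<Longrightarrow> (y' has_vector_derivative - (\<alpha> t *\<^sub>R y' t)
        + \<beta> t *\<^sub>R grad_y_reg gg K (\<epsilon> t) (x t + (\<theta> * t) *\<^sub>R x' t) (y t)) (at t within {t0..})"
proof -
  obtain x' x'' y' y'' where W: "W11_loc_deriv t0 x x'" "W11_loc_deriv t0 x' x''"
    "W11_loc_deriv t0 y y'" "W11_loc_deriv t0 y' y''"
    and ode: "AE t in lebesgue. t > t0 \<longrightarrow>
       x'' t + \<alpha> t *\<^sub>R x' t
         + \<beta> t *\<^sub>R grad_x_reg gf K (\<epsilon> t) (x t) (y t + (\<theta> * t) *\<^sub>R y' t) = 0 \<and>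
       y'' t + \<alpha> t *\<^sub>R y' t
         - \<beta> t *\<^sub>R grad_y_reg gg K (\<epsilon> t) (x t + (\<theta> * t) *\<^sub>R x' t) (y t) = 0"
    using traj unfolding gtrd_trajectory_def by blast
  note c = cont(1-3) W[THEN W11_loc_deriv_continuous]
  have mat: "continuous_on S (\<lambda>t. M *v u t)" if "continuous_on S u"
    for S and M :: "real^'i^'j" and u :: "real \<Rightarrow> real^'i"
    by (rule continuous_on_compose2[OF linear_continuous_on[OF matrix_vector_mul_bounded_linear] that]) auto
  have hx: "continuous_on {t0..} (\<lambda>t. - (\<alpha> t *\<^sub>R x' t)
        - \<beta> t *\<^sub>R grad_x_reg gf K (\<epsilon> t) (x t) (y t + (\<theta> * t) *\<^sub>R y' t))"
    unfolding grad_x_reg_def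
    by (intro continuous_intros c mat continuous_on_compose2[OF cont(4)]) auto
  have hy: "continuous_on {t0..} (\<lambda>t. - (\<alpha> t *\<^sub>R y' t)
        + \<beta> t *\<^sub>R grad_y_reg gg K (\<epsilon> t) (x t + (\<theta> * t) *\<^sub>R x' t) (y t))"
    unfolding grad_y_reg_def
    by (intro continuous_intros c mat continuous_on_compose2[OF cont(5)]) auto
  show thesis
  proof
    fix t assume t: "t \<ge> t0"
    show "(x has_vector_derivative x' t) (at t within {t0..})"
      by (rule W11_loc_deriv_has_vector_derivative[OF W(1) c(5) _ t]) simp
    show "(y has_vector_derivative y' t) (at t within {t0..})"
      by (rule W11_loc_deriv_has_vector_derivative[OF W(3) c(7) _ t]) simp
    show "(x' has_vector_derivative - (\<alpha> t *\<^sub>R x' t)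
        - \<beta> t *\<^sub>R grad_x_reg gf K (\<epsilon> t) (x t) (y t + (\<theta> * t) *\<^sub>R y' t)) (at t within {t0..})"
    proof (rule W11_loc_deriv_has_vector_derivative[OF W(2) hx _ t])
      show "AE t in lebesgue. t0 < t \<longrightarrow> x'' t = - (\<alpha> t *\<^sub>R x' t)
          - \<beta> t *\<^sub>R grad_x_reg gf K (\<epsilon> t) (x t) (y t + (\<theta> * t) *\<^sub>R y' t)"
        using ode by eventually_elim (auto simp: algebra_simps eq_neg_iff_add_eq_0)
    qed
    show "(y' has_vector_derivative - (\<alpha> t *\<^sub>R y' t)
        + \<beta> t *\<^sub>R grad_y_reg gg K (\<epsilon> t) (x t + (\<theta> * t) *\<^sub>R x' t) (y t)) (at t within {t0..})"
    proof (rule W11_loc_deriv_has_vector_derivative[OF W(4) hy _ t])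
      show "AE t in lebesgue. t0 < t \<longrightarrow> y'' t = - (\<alpha> t *\<^sub>R y' t)
          + \<beta> t *\<^sub>R grad_y_reg gg K (\<epsilon> t) (x t + (\<theta> * t) *\<^sub>R x' t) (y t)"
        using ode by eventually_elim (auto simp: algebra_simps eq_neg_iff_add_eq_0)
    qed
  qed
qed

lemma lagrangian_regularized_saddle:
  fixes f :: "real^'n \<Rightarrow> real" and g :: "real^'m \<Rightarrow> real" and K :: "real^'n^'m"
  assumes "convex_on UNIV f" "convex_on UNIV g"
    and "\<And>x. GDERIV f x :> gf x" "\<And>y. GDERIV g y :> gg y"
    and "L1-lipschitz_on UNIV gf" "L2-lipschitz_on UNIV gg"
  shows "regularized_saddle (\<lambda>z. f (fst z) + g (snd z)) (\<lambda>z. (gf (fst z), gg (snd z)))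
    (\<lambda>z. (transpose K *v snd z, - (K *v fst z))) (L1 + L2)"
proof (rule regularized_saddle.intro)
  let ?\<phi> = "\<lambda>z. f (fst z) + g (snd z)" and ?G = "\<lambda>z. (gf (fst z), gg (snd z))"
  show "convex_on UNIV ?\<phi>"
  proof (rule convex_onI)
    fix t :: real and z w :: "(real^'n) \<times> (real^'m)" assume "0 < t" "t < 1"
    then show "?\<phi> ((1 - t) *\<^sub>R z + t *\<^sub>R w) \<le> (1 - t) * ?\<phi> z + t * ?\<phi> w"
      using convex_onD[OF assms(1), of t "fst z" "fst w"] convex_onD[OF assms(2), of t "snd z" "snd w"]
      by (simp add: algebra_simps)
  qed simp
  show "GDERIV ?\<phi> z :> ?G z" for z :: "(real^'n) \<times> (real^'m)"
  proof -
    have f: "(f has_derivative (\<lambda>h. gf (fst z) \<bullet> h)) (at (fst z))"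
      and g: "(g has_derivative (\<lambda>h. gg (snd z) \<bullet> h)) (at (snd z))"
      using assms(3,4) by (auto simp: gderiv_def inner_commute)
    have "((\<lambda>z. f (fst z)) has_derivative (\<lambda>h. gf (fst z) \<bullet> fst h)) (at z)"
      by (rule has_derivative_compose[of fst fst z UNIV f, OF _ f])
        (rule bounded_linear.has_derivative[OF bounded_linear_fst has_derivative_ident])
    moreover have "((\<lambda>z. g (snd z)) has_derivative (\<lambda>h. gg (snd z) \<bullet> snd h)) (at z)"
      by (rule has_derivative_compose[of snd snd z UNIV g, OF _ g])
        (rule bounded_linear.has_derivative[OF bounded_linear_snd has_derivative_ident])
    ultimately show ?thesis
      unfolding gderiv_def by (rule has_derivative_eq_rhs[OF has_derivative_add])
        (simp add: fun_eq_iff inner_prod_def inner_commute)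
  qed
  show "(L1 + L2)-lipschitz_on UNIV ?G"
  proof (rule lipschitz_onI)
    fix z w :: "(real^'n) \<times> (real^'m)"
    have "dist (?G z) (?G w) \<le> dist (gf (fst z)) (gf (fst w)) + dist (gg (snd z)) (gg (snd w))"
      unfolding dist_prod_def by (simp add: sqrt_sum_squares_le_sum)
    also have "\<dots> \<le> L1 * dist (fst z) (fst w) + L2 * dist (snd z) (snd w)"
      using lipschitz_onD[OF assms(5)] lipschitz_onD[OF assms(6)] by (intro add_mono) auto
    also have "\<dots> \<le> L1 * dist z w + L2 * dist z w"
      using lipschitz_on_nonneg[OF assms(5)] lipschitz_on_nonneg[OF assms(6)]
      by (intro add_mono mult_left_mono dist_fst_le dist_snd_le)
    finally show "dist (?G z) (?G w) \<le> (L1 + L2) * dist z w"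
      by (simp add: distrib_right)
  qed (use lipschitz_on_nonneg[OF assms(5)] lipschitz_on_nonneg[OF assms(6)] in simp)
  show "bounded_linear (\<lambda>z. (transpose K *v snd z, - (K *v fst z)))"
    by (intro bounded_linear_Pair bounded_linear_minus
        bounded_linear_compose[OF matrix_vector_mul_bounded_linear] bounded_linear_fst bounded_linear_snd)
  show "(transpose K *v snd z, - (K *v fst z)) \<bullet> z = 0" for z :: "(real^'n) \<times> (real^'m)"
    using dot_lmul_matrix[of "snd z" K "fst z"] by (simp add: inner_prod_def inner_commute)
qed

lemma is_saddle_iff: "is_saddle L \<zeta> \<longleftrightarrow> (\<forall>z. 0 \<le> L (fst z) (snd \<zeta>) - L (fst \<zeta>) (snd z))"
proof
  assume s: "is_saddle L \<zeta>"
  show "\<forall>z. 0 \<le> L (fst z) (snd \<zeta>) - L (fst \<zeta>) (snd z)"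
  proof
    fix z
    have "L (fst \<zeta>) (snd z) \<le> L (fst \<zeta>) (snd \<zeta>)" "L (fst \<zeta>) (snd \<zeta>) \<le> L (fst z) (snd \<zeta>)"
      using s by (auto simp: is_saddle_def)
    then show "0 \<le> L (fst z) (snd \<zeta>) - L (fst \<zeta>) (snd z)"
      by simp
  qed
next
  assume gap: "\<forall>z. 0 \<le> L (fst z) (snd \<zeta>) - L (fst \<zeta>) (snd z)"
  show "is_saddle L \<zeta>"
    unfolding is_saddle_def
  proof (intro allI conjI)
    fix x y
    show "L (fst \<zeta>) y \<le> L (fst \<zeta>) (snd \<zeta>)"
      using gap[rule_format, of "(fst \<zeta>, y)"] by simp
    show "L (fst \<zeta>) (snd \<zeta>) \<le> L x (snd \<zeta>)"
      using gap[rule_format, of "(x, snd \<zeta>)"] by simp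
  qed
qed

lemma reg_lagrangian_0: "reg_lagrangian f g K 0 = lagrangian f g K"
  by (simp add: reg_lagrangian_def fun_eq_iff)

section \<open>Convergence to the minimum-norm saddle point\<close>

theorem proposition4p2:
  fixes f :: "real^'n \<Rightarrow> real" and gf :: "real^'n \<Rightarrow> real^'n"
    and g :: "real^'m \<Rightarrow> real" and gg :: "real^'m \<Rightarrow> real^'m"
    and K :: "real^'n^'m"
    and L1 L2 t0 \<theta> :: real
    and \<alpha> \<alpha>' \<beta> \<beta>' \<epsilon> \<epsilon>' :: "real \<Rightarrow> real"
    and \<Omega> :: "((real^'n) \<times> (real^'m)) set"
    and l \<Gamma> H \<Psi> R :: "real \<Rightarrow> real"
    and xt dxt Px :: "real \<Rightarrow> real^'n" and yt dyt Py :: "real \<Rightarrow> real^'m"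
  defines "\<Omega> \<equiv> {z. is_saddle (lagrangian f g K) z}"
    and "l \<equiv> \<lambda>t. 1 / (\<theta> * t) * (\<beta> t * \<epsilon> t - \<alpha>' t - \<alpha> t / t)"
    and "\<Gamma> \<equiv> \<lambda>t. \<alpha> t - (1 + \<theta>) / (\<theta> * t)"
    and "H \<equiv> \<lambda>t. \<beta> t + \<beta> t * \<epsilon> t + \<alpha> t - 1 / (\<theta> * t)"
    and "\<Psi> \<equiv> \<lambda>t. (\<bar>\<epsilon>' t\<bar> / \<epsilon> t)\<^sup>2 * ((H t)\<^sup>2 / l t + 1 / (t\<^sup>2 * \<Gamma> t))"
    and "xt \<equiv> \<lambda>t. fst (the_saddle (reg_lagrangian f g K (\<epsilon> t)))"
    and "yt \<equiv> \<lambda>t. snd (the_saddle (reg_lagrangian f g K (\<epsilon> t)))"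
    and "dxt \<equiv> \<lambda>t. vector_derivative xt (at t)"
    and "dyt \<equiv> \<lambda>t. vector_derivative yt (at t)"
    and "Px \<equiv> \<lambda>t. - (\<beta> t *\<^sub>R (transpose K *v dyt t)) - (\<beta> t * \<epsilon>' t) *\<^sub>R xt t
                    + ((\<alpha> t - 1 / t) / (\<theta> * t)) *\<^sub>R dxt t"
    and "Py \<equiv> \<lambda>t. \<beta> t *\<^sub>R (K *v dxt t) - (\<beta> t * \<epsilon>' t) *\<^sub>R yt t
                    + ((\<alpha> t - 1 / t) / (\<theta> * t)) *\<^sub>R dyt t"
    and "R \<equiv> \<lambda>t. ((norm (Px t))\<^sup>2 + (norm (Py t))\<^sup>2) / l t
                   + ((norm (dxt t))\<^sup>2 + (norm (dyt t))\<^sup>2) / (2 * \<theta>\<^sup>2 * t\<^sup>2 * \<Gamma> t)"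
  assumes f_convex: "convex_on UNIV f" and g_convex: "convex_on UNIV g"
    and f_grad: "\<And>x. GDERIV f x :> gf x" and g_grad: "\<And>y. GDERIV g y :> gg y"
    and gf_cont: "continuous_on UNIV gf" and gg_cont: "continuous_on UNIV gg"
    and L_pos: "L1 > 0" "L2 > 0"
    and gf_lipschitz: "L1-lipschitz_on UNIV gf" and gg_lipschitz: "L2-lipschitz_on UNIV gg"
    and \<Omega>_props: "\<Omega> \<noteq> {}" "closed \<Omega>" "convex \<Omega>"
    and t0_ge: "t0 \<ge> 1" and \<theta>_pos: "\<theta> > 0"
    and coeff_pos: "\<And>t. t \<ge> t0 \<Longrightarrow> \<alpha> t > 0" "\<And>t. t \<ge> t0 \<Longrightarrow> \<beta> t > 0"
                   "\<And>t. t \<ge> t0 \<Longrightarrow> \<epsilon> t > 0"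
    and coeff_deriv:
        "\<And>t. t \<ge> t0 \<Longrightarrow> (\<alpha> has_real_derivative \<alpha>' t) (at t within {t0..})"
        "\<And>t. t \<ge> t0 \<Longrightarrow> (\<beta> has_real_derivative \<beta>' t) (at t within {t0..})"
        "\<And>t. t \<ge> t0 \<Longrightarrow> (\<epsilon> has_real_derivative \<epsilon>' t) (at t within {t0..})"
    and coeff_deriv_cont:
        "continuous_on {t0..} \<alpha>'" "continuous_on {t0..} \<beta>'" "continuous_on {t0..} \<epsilon>'"
    and \<epsilon>_nonincr: "antimono_on {t0..} \<epsilon>"
    and \<epsilon>_lim: "(\<epsilon> \<longlongrightarrow> 0) at_top"
    and cond1: "\<And>t. t \<ge> t0 \<Longrightarrow> 1 + \<theta> - \<theta> * t * \<alpha> t < 0"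
    and cond2: "\<And>t. t \<ge> t0 \<Longrightarrow> (2 * \<theta> - 1) * \<beta> t + \<theta> * t * \<beta>' t \<le> 0"
    and cond3: "\<And>t. t \<ge> t0 \<Longrightarrow> \<alpha> t + t * \<alpha>' t < t * \<beta> t * \<epsilon> t"
    and growth: "filterlim (\<lambda>t. t\<^sup>2 * \<beta> t * \<epsilon> t) at_top at_top"
    and \<Psi>_lim: "((\<lambda>t. integral {t0..t} (\<lambda>\<tau>. \<tau>\<^sup>2 * \<Psi> \<tau>) / (t\<^sup>2 * \<beta> t * \<epsilon> t)) \<longlongrightarrow> 0) at_top"
  shows "(\<forall>t\<ge>t0. (\<lambda>\<tau>. \<tau>\<^sup>2 * R \<tau>) absolutely_integrable_on {t0..t})
       \<and> ((\<lambda>t. integral {t0..t} (\<lambda>\<tau>. \<tau>\<^sup>2 * R \<tau>) / (t\<^sup>2 * \<beta> t * \<epsilon> t)) \<longlongrightarrow> 0) at_top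
       \<and> (\<forall>x y. gtrd_trajectory t0 \<theta> \<alpha> \<beta> \<epsilon> gf gg K x y \<longrightarrow>
             ((\<lambda>t. norm ((x t, y t) - closest_point \<Omega> 0)) \<longlongrightarrow> 0) at_top)"
proof -
  \<comment> \<open>Keeps the operator \<open>?A\<close> in the form in which the locale is interpreted.\<close>
  note transpose_matrix_vector [simp del]
  let ?\<phi> = "\<lambda>z. f (fst z) + g (snd z)" and ?G = "\<lambda>z. (gf (fst z), gg (snd z))"
    and ?A = "\<lambda>z. (transpose K *v snd z, - (K *v fst z))"
  interpret rs: regularized_saddle ?\<phi> ?G ?A "L1 + L2"
    by (rule lagrangian_regularized_saddle) fact+
  have gap_eq: "rs.gap e \<zeta> z = reg_lagrangian f g K e (fst z) (snd \<zeta>) - reg_lagrangian f g K e (fst \<zeta>) (snd z)"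
    for e \<zeta> z
  proof -
    have "(norm z)\<^sup>2 = (norm (fst z))\<^sup>2 + (norm (snd z))\<^sup>2" for z :: "(real^'n) \<times> (real^'m)"
      by (simp add: norm_prod_def)
    moreover have "?A \<zeta> \<bullet> z = (K *v fst z) \<bullet> snd \<zeta> - (K *v fst \<zeta>) \<bullet> snd z"
      using dot_lmul_matrix[of "snd \<zeta>" K "fst z"]
      by (simp add: inner_prod_def inner_commute transpose_matrix_vector)
    ultimately show ?thesis
      by (simp add: rs.gap_def reg_lagrangian_def lagrangian_def algebra_simps)
  qed
  have saddle_iff: "is_saddle (reg_lagrangian f g K e) \<zeta> \<longleftrightarrow> rs.T e \<zeta> = 0" if "e \<ge> 0" for e \<zeta>
    unfolding is_saddle_iff rs.gap_nonneg_iff[OF that, symmetric] gap_eq ..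
  have \<Omega>_eq: "\<Omega> = {z. rs.T 0 z = 0}"
    using saddle_iff[of 0] by (simp add: \<Omega>_def reg_lagrangian_0)
  have the_saddle_eq: "the_saddle (reg_lagrangian f g K e) = rs.zsol e" if "e > 0" for e
    using saddle_iff[of e] that by (simp add: the_saddle_def rs.zsol_def)
  define p where "p = closest_point \<Omega> 0"
  have p: "p \<in> \<Omega>"
    unfolding p_def by (rule closest_point_in_set[OF \<Omega>_props(2,1)])
  have p_le: "norm p \<le> norm q" if "q \<in> \<Omega>" for q
    using closest_point_le[OF \<Omega>_props(2) that, of 0] by (simp add: p_def)
  have p_unique: "q = p" if "q \<in> \<Omega>" "norm q \<le> norm p" for q
    unfolding p_def using that p_le
    by (intro closest_point_unique \<Omega>_props) (auto intro: order_trans)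
  interpret tc: tikhonov_coefficients ?\<phi> ?G ?A "L1 + L2" t0 \<theta> \<alpha> \<alpha>' \<beta> \<beta>' \<epsilon> \<epsilon>' p
    using t0_ge \<theta>_pos coeff_pos coeff_deriv coeff_deriv_cont(1,3) \<epsilon>_nonincr cond1 cond2 cond3 p
    by unfold_locales (auto simp: \<Omega>_eq)
  have \<Psi>_eq: "\<Psi> = tc.\<Psi>"
    by (simp add: fun_eq_iff \<Psi>_def tc.\<Psi>_def H_def tc.H_def l_def tc.l_def \<Gamma>_def tc.\<Gamma>_def)
  have zt_eq: "tc.zt t = (xt t, yt t)" if "t \<ge> t0" for t
    using that coeff_pos(3) by (simp add: tc.zt_def xt_def yt_def the_saddle_eq)
  \<comment> \<open>Where \<open>zt\<close> is not differentiable, \<open>dz\<close> has an unspecified value.\<close>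
  define dz where "dz t = (dxt t, dyt t)" for t
  have dz: "(tc.zt has_vector_derivative dz t) (at t)" if t: "t0 < t" "tc.zt differentiable (at t)" for t
  proof -
    obtain D where D: "(tc.zt has_vector_derivative D) (at t)"
      using t(2) by (auto simp: vector_derivative_works)
    then have "((\<lambda>t. (xt t, yt t)) has_vector_derivative D) (at t)"
      by (rule has_vector_derivative_transform_within_open[of _ _ _ "{t0<..}"])
        (use t(1) zt_eq in auto)
    then have "(xt has_vector_derivative fst D) (at t)" "(yt has_vector_derivative snd D) (at t)"
      using bounded_linear.has_vector_derivative[OF bounded_linear_fst]
        bounded_linear.has_vector_derivative[OF bounded_linear_snd] by fastforce+
    then have "dz t = D"
      by (simp add: dz_def dxt_def dyt_def vector_derivative_at)
    then show ?thesis
      using D by simp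
  qed
  have R_eq: "R t = tc.residual (dz t) t" if "t \<ge> t0" for t
  proof -
    have P: "tc.P (dz t) t = (Px t, Py t)"
      using zt_eq[OF that] by (simp add: tc.P_def dz_def Px_def Py_def)
    have "(norm (a, b))\<^sup>2 = (norm a)\<^sup>2 + (norm b)\<^sup>2" for a :: "real^'n" and b :: "real^'m"
      by (simp add: norm_prod_def)
    then show ?thesis
      unfolding tc.residual_def P by (simp add: R_def dz_def l_def tc.l_def \<Gamma>_def tc.\<Gamma>_def)
  qed
  have R_integral: "integral {t0..t} (\<lambda>\<tau>. \<tau>\<^sup>2 * R \<tau>) = integral {t0..t} (\<lambda>\<tau>. \<tau>\<^sup>2 * tc.residual (dz \<tau>) \<tau>)" for t
    by (rule integral_cong) (simp add: R_eq)
  have R_integrable: "(\<lambda>\<tau>. \<tau>\<^sup>2 * R \<tau>) absolutely_integrable_on {t0..t}" if "t \<ge> t0" for t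
    using tc.residual_integrable(1)[OF dz that]
  proof (rule absolutely_integrable_spike[OF _ negligible_empty])
    show "\<tau>\<^sup>2 * R \<tau> = \<tau>\<^sup>2 * tc.residual (dz \<tau>) \<tau>" if "\<tau> \<in> {t0..t} - {}" for \<tau>
      using that R_eq[of \<tau>] by simp
  qed
  have R_lim: "((\<lambda>t. integral {t0..t} (\<lambda>\<tau>. \<tau>\<^sup>2 * R \<tau>) / (t\<^sup>2 * \<beta> t * \<epsilon> t)) \<longlongrightarrow> 0) at_top"
    unfolding R_integral by (rule tc.residual_tendsto[OF dz \<Psi>_lim[unfolded \<Psi>_eq]])
  have zt_lim: "(tc.zt \<longlongrightarrow> p) at_top"
  proof -
    have "(rs.zsol \<longlongrightarrow> p) (at_right 0)"
      using p p_unique by (intro rs.zsol_tendsto) (auto simp: \<Omega>_eq)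
    moreover have "filterlim \<epsilon> (at_right 0) at_top"
    proof -
      have "eventually (\<lambda>t. \<epsilon> t \<in> {0<..} \<and> \<epsilon> t \<noteq> 0) at_top"
        using eventually_ge_at_top[of t0] by eventually_elim (use coeff_pos(3) in force)
      then show ?thesis
        using \<epsilon>_lim by (simp add: filterlim_at)
    qed
    ultimately show ?thesis
      unfolding tc.zt_def by (rule filterlim_compose)
  qed
  have "((\<lambda>t. norm ((x t, y t) - p)) \<longlongrightarrow> 0) at_top"
    if traj: "gtrd_trajectory t0 \<theta> \<alpha> \<beta> \<epsilon> gf gg K x y" for x y
  proof -
    obtain x' y' where d:
      "\<And>t. t \<ge> t0 \<Longrightarrow> (x has_vector_derivative x' t) (at t within {t0..})"
      "\<And>t. t \<ge> t0 \<Longrightarrow> (y has_vector_derivative y' t) (at t within {t0..})"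
      "\<And>t. t \<ge> t0 \<Longrightarrow> (x' has_vector_derivative - (\<alpha> t *\<^sub>R x' t)
          - \<beta> t *\<^sub>R grad_x_reg gf K (\<epsilon> t) (x t) (y t + (\<theta> * t) *\<^sub>R y' t)) (at t within {t0..})"
      "\<And>t. t \<ge> t0 \<Longrightarrow> (y' has_vector_derivative - (\<alpha> t *\<^sub>R y' t)
          + \<beta> t *\<^sub>R grad_y_reg gg K (\<epsilon> t) (x t + (\<theta> * t) *\<^sub>R x' t) (y t)) (at t within {t0..})"
      using gtrd_trajectory_classical[OF traj tc.continuous_coefficients gf_cont gg_cont] by blast
    interpret tt: tikhonov_trajectory ?\<phi> ?G ?A "L1 + L2" t0 \<theta> \<alpha> \<alpha>' \<beta> \<beta>' \<epsilon> \<epsilon>' p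
      "\<lambda>t. (x t, y t)" "\<lambda>t. (x' t, y' t)"
      "\<lambda>t. (- (\<alpha> t *\<^sub>R x' t) - \<beta> t *\<^sub>R grad_x_reg gf K (\<epsilon> t) (x t) (y t + (\<theta> * t) *\<^sub>R y' t),
            - (\<alpha> t *\<^sub>R y' t) + \<beta> t *\<^sub>R grad_y_reg gg K (\<epsilon> t) (x t + (\<theta> * t) *\<^sub>R x' t) (y t))"
      using d by unfold_locales
        (auto simp: grad_x_reg_def grad_y_reg_def algebra_simps zero_prod_def intro!: has_vector_derivative_Pair)
    have "((\<lambda>t. ((x t, y t) - tc.zt t) + tc.zt t) \<longlongrightarrow> 0 + p) at_top"
      by (intro tendsto_add tt.trajectory_tendsto_zt zt_lim growth \<Psi>_lim[unfolded \<Psi>_eq])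
    then have "((\<lambda>t. (x t, y t)) \<longlongrightarrow> p) at_top"
      by simp
    then show ?thesis
      by (simp add: tendsto_norm_zero_iff LIM_zero_iff)
  qed
  then show ?thesis
    using R_integrable R_lim unfolding p_def by blast
qed

end
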